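(* Let $K_5$ be the complete 3-graph on 5 vertices, and let $\mathcal{G}$ be the family of 3-graphs on 5 vertices with exactly 8 edges. For each $n$, let $m(n)$ be the maximum number of edges of a 3-graph $G$ on $n$ vertices that contains no copy of $K_5$ as a subgraph and no 5-vertex subset $S\subseteq V(G)$ spanning exactly 8 edges (i.e. no induced copy of a member of $\mathcal{G}$). Then \[\lim_{n\to\infty} \frac{m(n)}{\binom{n}{3}} = \frac34.\]
   Context: A 3-graph $G=(V,E)$ consists of a vertex set $V$ and a set $E$ of 3-element subsets of $V$. A set $S\subseteq V$ spans $k$ edges if exactly $k$ edges of $G$ are contained in $S$. The limit of $m(n)/\binom n3$ exists. *)

theory Defs
  imports Complex_Main
begin

definition three_graph :: "'a set \<Rightarrow> 'a set set \<Rightarrow> bool" where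
  "three_graph V E \<longleftrightarrow> finite V \<and> (\<forall>e\<in>E. e \<subseteq> V \<and> card e = 3)"

definition complete_edges :: "'a set \<Rightarrow> 'a set set" where
  "complete_edges V = {e. e \<subseteq> V \<and> card e = 3}"

(* Subgraph containment is not induced: edges of F go to edges of G,
   non-edges of F are unconstrained. *)
definition contains_copy :: "'b set \<Rightarrow> 'b set set \<Rightarrow> 'a set \<Rightarrow> 'a set set \<Rightarrow> bool" where
  "contains_copy VF EF V E \<longleftrightarrow>
     (\<exists>f. inj_on f VF \<and> f ` VF \<subseteq> V \<and> (\<forall>e\<in>EF. f ` e \<in> E))"

definition contains_K5 :: "'a set \<Rightarrow> 'a set set \<Rightarrow> bool" where
  "contains_K5 V E \<longleftrightarrow> contains_copy {..<5::nat} (complete_edges {..<5::nat}) V E"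

definition spans :: "'a set set \<Rightarrow> 'a set \<Rightarrow> nat \<Rightarrow> bool" where
  "spans E S k \<longleftrightarrow> card {e \<in> E. e \<subseteq> S} = k"

definition admissible :: "'a set \<Rightarrow> 'a set set \<Rightarrow> bool" where
  "admissible V E \<longleftrightarrow> three_graph V E \<and> \<not> contains_K5 V E \<and>
     \<not> (\<exists>S. S \<subseteq> V \<and> card S = 5 \<and> spans E S 8)"

(* Vertices are taken from nat; by max_edges_attained and max_edges_upper below
   this loses no generality, and the maximum is over a finite nonempty set. *)
definition max_edges :: "nat \<Rightarrow> nat" where
  "max_edges n = Max {card E | (V :: nat set) E. card V = n \<and> admissible V E}"

lemma three_graph_card_le:
  assumes "three_graph V E" shows "finite E" "card E \<le> card V choose 3"
proof -
  have fin: "finite V" and sub: "E \<subseteq> {e. e \<subseteq> V \<and> card e = 3}"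
    using assms by (auto simp: three_graph_def)
  have "finite {e. e \<subseteq> V \<and> card e = 3}" using fin by simp
  then show "finite E" "card E \<le> card V choose 3"
    using finite_subset[OF sub] card_mono[OF _ sub] n_subsets[OF fin, of 3] by simp_all
qed

lemma finite_max_edges_set:
  "finite {card E | (V :: nat set) E. card V = n \<and> admissible V E}"
  by (rule finite_subset[of _ "{..n choose 3}"])
     (auto simp: admissible_def dest: three_graph_card_le(2))

lemma complete_edges_5_nonempty: "complete_edges {..<5::nat} \<noteq> {}"
proof -
  have "{0,1,2} \<in> complete_edges {..<5::nat}" by (auto simp: complete_edges_def)
  then show ?thesis by blast
qed

lemma admissible_empty: "finite V \<Longrightarrow> admissible V {}"
  using complete_edges_5_nonempty
  by (auto simp: admissible_def three_graph_def spans_def contains_K5_def contains_copy_def)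

lemma max_edges_attained:
  "\<exists>(V :: nat set) E. card V = n \<and> admissible V E \<and> card E = max_edges n"
proof -
  have "card ({} :: nat set set) \<in> {card E | (V :: nat set) E. card V = n \<and> admissible V E}"
    using admissible_empty[of "{..<n}"] card_lessThan[of n] by blast
  then have "max_edges n \<in> {card E | (V :: nat set) E. card V = n \<and> admissible V E}"
    unfolding max_edges_def by (intro Max_in finite_max_edges_set) blast
  then show ?thesis by (smt (verit) mem_Collect_eq)
qed

lemma admissible_image:
  assumes "inj_on h V" "admissible V E"
  shows "admissible (h ` V) ((`) h ` E)"
proof -
  have tg: "three_graph V E" and nk: "\<not> contains_K5 V E"
    and ns: "\<And>S. S \<subseteq> V \<Longrightarrow> card S = 5 \<Longrightarrow> \<not> spans E S 8"
    using assms(2) by (auto simp: admissible_def)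
  have EV: "e \<subseteq> V" if "e \<in> E" for e using tg that by (auto simp: three_graph_def)
  have inj2: "inj_on ((`) h) E"
    using assms(1) EV by (intro inj_onI) (metis inj_on_image_eq_iff)
  have 1: "three_graph (h ` V) ((`) h ` E)"
    using tg assms(1) by (auto simp: three_graph_def card_image[OF inj_on_subset])
  have 2: "\<not> contains_K5 (h ` V) ((`) h ` E)"
  proof
    assume "contains_K5 (h ` V) ((`) h ` E)"
    then obtain f where f: "inj_on f {..<5::nat}" "f ` {..<5} \<subseteq> h ` V"
      "\<And>e. e \<in> complete_edges {..<5} \<Longrightarrow> f ` e \<in> (`) h ` E"
      by (auto simp: contains_K5_def contains_copy_def)
    let ?g = "inv_into V h \<circ> f"
    have "inj_on ?g {..<5}"
      using f(1,2) by (intro comp_inj_on inj_on_inv_into) auto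
    moreover have "?g ` {..<5} \<subseteq> V"
      using f(2) by (auto intro!: inv_into_into)
    moreover have "?g ` e \<in> E" if e: "e \<in> complete_edges {..<5}" for e
    proof -
      obtain e' where e': "e' \<in> E" "f ` e = h ` e'" using f(3)[OF e] by auto
      have "?g ` e = inv_into V h ` h ` e'" by (simp only: image_comp [symmetric] e'(2))
      also have "\<dots> = e'" using assms(1) EV[OF e'(1)] by (rule inv_into_image_cancel)
      finally show ?thesis using e'(1) by simp
    qed
    ultimately show False
      using nk unfolding contains_K5_def contains_copy_def by blast
  qed
  have 3: "\<not> spans ((`) h ` E) S 8" if S: "S \<subseteq> h ` V" "card S = 5" for S
  proof -
    obtain T where T: "T \<subseteq> V" "S = h ` T" using S(1) by (auto simp: subset_image_iff)
    have cT: "card T = 5" using T S(2) assms(1) by (metis card_image inj_on_subset)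
    have "e \<subseteq> T" if "e \<in> E" "h ` e \<subseteq> h ` T" for e
      using that EV[OF that(1)] T(1) inj_on_image_mem_iff[OF assms(1) _ T(1)] by blast
    then have "{e \<in> (`) h ` E. e \<subseteq> S} = (`) h ` {e \<in> E. e \<subseteq> T}"
      unfolding T(2) by blast
    then have "card {e \<in> (`) h ` E. e \<subseteq> S} = card {e \<in> E. e \<subseteq> T}"
      using inj2 by (simp add: card_image inj_on_subset)
    then show ?thesis using ns[OF T(1) cT] by (simp add: spans_def)
  qed
  show ?thesis using 1 2 3 by (auto simp: admissible_def)
qed

lemma max_edges_upper:
  fixes V :: "'a set"
  assumes "admissible V E"
  shows "card E \<le> max_edges (card V)"
proof -
  have tg: "three_graph V E" using assms by (simp add: admissible_def)
  then have "finite V" by (simp add: three_graph_def)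
  then obtain h :: "'a \<Rightarrow> nat" where h: "inj_on h V"
    using finite_imp_inj_to_nat_seg by blast
  have "inj_on ((`) h) E"
    using h tg by (intro inj_onI) (metis inj_on_image_eq_iff three_graph_def)
  then have "card E = card ((`) h ` E)" by (simp add: card_image)
  moreover have "card (h ` V) = card V" using h by (rule card_image)
  ultimately have "card E \<in> {card E | (W :: nat set) E. card W = card V \<and> admissible W E}"
    using admissible_image[OF h assms] by blast
  then show ?thesis unfolding max_edges_def by (intro Max_ge finite_max_edges_set)
qed

end

theory Submission
  imports Defs "HOL-Combinatorics.Multiset_Permutations" "HOL-Library.List_Lexorder"
    "HOL-Real_Asymp.Real_Asymp"
begin

text \<open>
The lower bound comes from splitting the vertices into two halves and taking all triples that meet both
of them: a five-set then spans 0, 6 or 9 edges.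

The upper bound is a flag-algebra certificate on six vertices. For vertices \<open>u, v, a, b\<close> one considers
a weight \<open>phi\<close> and an asymmetry \<open>omega\<close> of the pair \<open>{a, b}\<close> relative to \<open>{u, v}\<close>, and for a complete
quadruple \<open>a, b, c, d\<close> and a vertex \<open>x\<close> a sign \<open>delta\<close> that records whether \<open>x\<close> prefers the side \<open>{c, d}\<close> or
the side \<open>{a, b}\<close>. All three average to zero on the extremal configuration. Write \<open>psi\<close> for the difference
\<open>36 - 12 (uva + uvb + uvc + uvd) - phi phi - 32 omega omega - 60 delta delta\<close>, where \<open>uva\<close> is 1 if
\<open>{u, v, a}\<close> is an edge and 0 otherwise. Summed over all 6-tuples the three products become sums of squares,
so the sum of \<open>psi\<close> is at most \<open>36 n^6 - 48 n^3 * 6 m\<close>, where \<open>m\<close> is the number of edges. On the other hand the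
sum of \<open>psi\<close> over the 720 orderings of any six vertices is nonnegative, a finite check. Up to the degenerate
tuples this gives \<open>m \<le> n^3 / 8\<close>.
\<close>

subsection \<open>The certificate and its finite check\<close>

text \<open>
The table values and the multipliers in \<open>psi\<close> are a rounded solution of the semidefinite program over
six-vertex configurations. The arguments of \<open>phi_tab\<close> and \<open>omega_tab\<close> are the triples \<open>uva\<close>, \<open>uvb\<close>, \<open>uab\<close>,
\<open>vab\<close>, those of \<open>delta_tab\<close> the triples \<open>xab\<close>, \<open>xcd\<close>, \<open>xac\<close>, \<open>xbd\<close>, \<open>xad\<close>, \<open>xbc\<close>. The sign \<open>delta\<close> is nonzero
if the non-edges at \<open>x\<close> form a single pair or a path, and the two odd vertices of that graph are \<open>{c, d}\<close>
(value 1) or \<open>{a, b}\<close> (value -1).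
\<close>

fun phi_tab :: "bool \<Rightarrow> bool \<Rightarrow> bool \<Rightarrow> bool \<Rightarrow> int" where
  "phi_tab False False False False = 6"
| "phi_tab False False _ _ = 0"
| "phi_tab True True False False = -1"
| "phi_tab True True True True = -4"
| "phi_tab True True _ _ = 4"
| "phi_tab _ _ False False = 4"
| "phi_tab _ _ True True = -1"
| "phi_tab _ _ _ _ = 3"

fun omega_tab :: "bool \<Rightarrow> bool \<Rightarrow> bool \<Rightarrow> bool \<Rightarrow> int" where
  "omega_tab True True True False = 1"
| "omega_tab True True False True = -1"
| "omega_tab _ _ _ _ = 0"

fun delta_tab :: "bool \<Rightarrow> bool \<Rightarrow> bool \<Rightarrow> bool \<Rightarrow> bool \<Rightarrow> bool \<Rightarrow> int" where
  "delta_tab True False True True True True = 1"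
| "delta_tab True False False False True True = -1"
| "delta_tab True False True True False False = -1"
| "delta_tab False True True True True True = -1"
| "delta_tab False True False False True True = 1"
| "delta_tab False True True True False False = 1"
| "delta_tab _ _ _ _ _ _ = 0"

definition phi :: "('a \<Rightarrow> 'a \<Rightarrow> 'a \<Rightarrow> bool) \<Rightarrow> 'a \<Rightarrow> 'a \<Rightarrow> 'a \<Rightarrow> 'a \<Rightarrow> int" where
  "phi E u v a b = phi_tab (E u v a) (E u v b) (E u a b) (E v a b)"

definition omega :: "('a \<Rightarrow> 'a \<Rightarrow> 'a \<Rightarrow> bool) \<Rightarrow> 'a \<Rightarrow> 'a \<Rightarrow> 'a \<Rightarrow> 'a \<Rightarrow> int" where
  "omega E u v a b = omega_tab (E u v a) (E u v b) (E u a b) (E v a b)"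

definition delta :: "('a \<Rightarrow> 'a \<Rightarrow> 'a \<Rightarrow> bool) \<Rightarrow> 'a \<Rightarrow> 'a \<Rightarrow> 'a \<Rightarrow> 'a \<Rightarrow> 'a \<Rightarrow> int" where
  "delta E a b c d x = (if E a b c \<and> E a b d \<and> E a c d \<and> E b c d
     then delta_tab (E x a b) (E x c d) (E x a c) (E x b d) (E x a d) (E x b c) else 0)"

definition psi :: "('a \<Rightarrow> 'a \<Rightarrow> 'a \<Rightarrow> bool) \<Rightarrow> 'a \<Rightarrow> 'a \<Rightarrow> 'a \<Rightarrow> 'a \<Rightarrow> 'a \<Rightarrow> 'a \<Rightarrow> int" where
  "psi E u v a b c d =
     36 - 12 * (of_bool (E u v a) + of_bool (E u v b) + of_bool (E u v c) + of_bool (E u v d))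
     - phi E u v a b * phi E u v c d - 32 * (omega E u v a b * omega E u v c d)
     - 60 * (delta E a b c d u * delta E a b c d v)"

text \<open>The two \<open>delta\<close> factors share one completeness test on \<open>a\<close>,
  \<open>b\<close>, \<open>c\<close>, \<open>d\<close>. As nested conditionals it is evaluated edge
  by edge, and the tables for \<open>u\<close> and \<open>v\<close> are consulted only for complete
  quadruples.\<close>

lemma psi_eq:
  "psi E u v a b c d = 36 - 12 * (of_bool (E u v a) + of_bool (E u v b) + of_bool (E u v c) + of_bool (E u v d))
    - phi_tab (E u v a) (E u v b) (E u a b) (E v a b) * phi_tab (E u v c) (E u v d) (E u c d) (E v c d)
    - 32 * (omega_tab (E u v a) (E u v b) (E u a b) (E v a b) * omega_tab (E u v c) (E u v d) (E u c d) (E v c d))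
    - (if E a b c then if E a b d then if E a c d then if E b c d
       then 60 * (delta_tab (E u a b) (E u c d) (E u a c) (E u b d) (E u a d) (E u b c)
          * delta_tab (E v a b) (E v c d) (E v a c) (E v b d) (E v a d) (E v b c)) else 0 else 0 else 0 else 0)"
  by (simp add: psi_def phi_def omega_def delta_def)

definition triples :: "nat \<Rightarrow> (nat \<times> nat \<times> nat) list" where
  "triples n = [(i, j, k). k \<leftarrow> [0..<n], j \<leftarrow> [0..<k], i \<leftarrow> [0..<j]]"

text \<open>
A 3-graph on \<open>{..<n}\<close> is encoded by the list of its truth values on \<open>triples n\<close>, in colexicographic order;
\<open>triple_index\<close> is the combinatorial number system of that order, so initial segments of the list are
induced subgraphs.
\<close>

definition triple_index :: "nat \<Rightarrow> nat \<Rightarrow> nat \<Rightarrow> nat" where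
  "triple_index i j k = (let a = min i (min j k); c = max i (max j k); b = i + j + k - a - c
     in (c choose 3) + (b choose 2) + a)"

definition edge :: "bool list \<Rightarrow> nat \<Rightarrow> nat \<Rightarrow> nat \<Rightarrow> bool" where
  "edge bs i j k = bs ! triple_index i j k"

text \<open>\<open>False\<close> comes before \<open>True\<close>. Pattern matching lets evaluation
  stop at the first difference. On lists of equal length, the case that occurs in the checks, this
  is the library order by \<open>lex_le_iff\<close>.\<close>

fun lex_le :: "bool list \<Rightarrow> bool list \<Rightarrow> bool" where
  "lex_le [] ys = True"
| "lex_le xs [] = True"
| "lex_le (False # xs) (True # ys) = True"
| "lex_le (True # xs) (False # ys) = False"
| "lex_le (True # xs) (True # ys) = lex_le xs ys"
| "lex_le (False # xs) (False # ys) = lex_le xs ys"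

definition pairs :: "nat \<Rightarrow> (nat \<times> nat) list" where
  "pairs n = [(i, j). j \<leftarrow> [0..<n], i \<leftarrow> [0..<j]]"

text \<open>
Symmetry breaking: only lists that no transposition of vertices makes lexicographically smaller have to be
checked. The condition is inherited by the subgraph on the first five vertices, which prunes the search early.
\<close>

definition transp_minimal :: "nat \<Rightarrow> bool list \<Rightarrow> bool" where
  "transp_minimal n bs \<longleftrightarrow> (\<forall>(a, b) \<in> set (pairs n).
     lex_le bs (map (\<lambda>(i, j, k). edge bs (transpose a b i) (transpose a b j) (transpose a b k)) (triples n)))"

text \<open>Meant for the ten triples of a five-set: no non-edge means a copy of \<open>K5\<close>
  and two non-edges mean exactly 8 edges, the two excluded cases. \<open>m\<close> accumulates the
  non-edges seen so far.\<close>

fun nonedges_ok :: "nat \<Rightarrow> bool list \<Rightarrow> bool" where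
  "nonedges_ok m [] \<longleftrightarrow> m \<noteq> 0 \<and> m \<noteq> 2"
| "nonedges_ok m (True # bs) = nonedges_ok m bs"
| "nonedges_ok m (False # bs) = nonedges_ok (Suc m) bs"

text \<open>A five-subset of six vertices is indexed by the vertex \<open>x\<close> that it omits.
  For \<open>x = 5\<close> the result is the first half of \<open>triples 6\<close>.\<close>

definition triples_avoiding :: "nat \<Rightarrow> (nat \<times> nat \<times> nat) list" where
  "triples_avoiding x = [(i, j, k) \<leftarrow> triples 6. x \<noteq> i \<and> x \<noteq> j \<and> x \<noteq> k]"

definition fives_ok :: "bool list \<Rightarrow> bool" where
  "fives_ok bs \<longleftrightarrow> (\<forall>x \<in> set [0..<6]. nonedges_ok 0 (map (\<lambda>(i, j, k). edge bs i j k) (triples_avoiding x)))"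

text \<open>
\<open>psi\<close> is invariant under a group of order 16; these are the 45 = 720 / 16 representatives of its orbits.
\<close>

definition orderings :: "(nat \<times> nat \<times> nat \<times> nat \<times> nat \<times> nat) list" where
  "orderings = [(u, v, a, b, c, d). u \<leftarrow> [0..<6], v \<leftarrow> [0..<6], u < v,
     a \<leftarrow> [0..<6], a \<notin> {u, v}, b \<leftarrow> [0..<6], a < b \<and> b \<notin> {u, v},
     c \<leftarrow> [0..<6], a < c \<and> c \<notin> {u, v, b}, d \<leftarrow> [0..<6], c < d \<and> d \<notin> {u, v, a, b}]"

definition psi_sum :: "bool list \<Rightarrow> int" where
  "psi_sum bs = (\<Sum>(u, v, a, b, c, d) \<leftarrow> orderings. psi (edge bs) u v a b c d)"

lemma upt_to_6:
  "[0..<6::nat] = [0,1,2,3,4,5]" "[0..<5::nat] = [0,1,2,3,4]" "[0..<4::nat] = [0,1,2,3]"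
  "[0..<3::nat] = [0,1,2]" "[0..<2::nat] = [0,1]"
  by (simp_all add: upt_rec)

context
  notes upt_to_6 [simp]
begin

lemmas orderings_list = orderings_def [simplified]
lemmas triples_list = triples_def [of 6, simplified] triples_def [of 5, simplified]
lemmas pairs_list = pairs_def [of 6, simplified] pairs_def [of 5, simplified]
lemmas triples_avoiding_list =
  triples_avoiding_def [of 0, unfolded triples_list, simplified]
  triples_avoiding_def [of 1, unfolded triples_list, simplified, folded One_nat_def]
  triples_avoiding_def [of 2, unfolded triples_list, simplified]
  triples_avoiding_def [of 3, unfolded triples_list, simplified]
  triples_avoiding_def [of 4, unfolded triples_list, simplified]
  triples_avoiding_def [of 5, unfolded triples_list, simplified]

end

lemma triple_index_sorted: "i < j \<Longrightarrow> j < k \<Longrightarrow> triple_index i j k = (k choose 3) + (j choose 2) + i"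
  by (simp add: triple_index_def Let_def)

lemma edge_swap12: "edge bs i j k = edge bs j i k"
  by (simp add: edge_def triple_index_def Let_def ac_simps min.left_commute max.left_commute)

lemma edge_swap23: "edge bs i j k = edge bs i k j"
  by (simp add: edge_def triple_index_def Let_def ac_simps)

lemma choose_small:
  "(2::nat) choose 3 = 0" "(3::nat) choose 3 = 1" "(4::nat) choose 3 = 4" "(5::nat) choose 3 = 10"
  "(1::nat) choose 2 = 0" "(2::nat) choose 2 = 1" "(3::nat) choose 2 = 3" "(4::nat) choose 2 = 6"
  by (simp_all add: numeral_eq_Suc)

lemma edge_sorted:
  "edge [b0,b1,b2,b3,b4,b5,b6,b7,b8,b9,b10,b11,b12,b13,b14,b15,b16,b17,b18,b19] 0 1 2 = b0"
  "edge [b0,b1,b2,b3,b4,b5,b6,b7,b8,b9,b10,b11,b12,b13,b14,b15,b16,b17,b18,b19] 0 1 3 = b1"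
  "edge [b0,b1,b2,b3,b4,b5,b6,b7,b8,b9,b10,b11,b12,b13,b14,b15,b16,b17,b18,b19] 0 2 3 = b2"
  "edge [b0,b1,b2,b3,b4,b5,b6,b7,b8,b9,b10,b11,b12,b13,b14,b15,b16,b17,b18,b19] 1 2 3 = b3"
  "edge [b0,b1,b2,b3,b4,b5,b6,b7,b8,b9,b10,b11,b12,b13,b14,b15,b16,b17,b18,b19] 0 1 4 = b4"
  "edge [b0,b1,b2,b3,b4,b5,b6,b7,b8,b9,b10,b11,b12,b13,b14,b15,b16,b17,b18,b19] 0 2 4 = b5"
  "edge [b0,b1,b2,b3,b4,b5,b6,b7,b8,b9,b10,b11,b12,b13,b14,b15,b16,b17,b18,b19] 1 2 4 = b6"
  "edge [b0,b1,b2,b3,b4,b5,b6,b7,b8,b9,b10,b11,b12,b13,b14,b15,b16,b17,b18,b19] 0 3 4 = b7"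
  "edge [b0,b1,b2,b3,b4,b5,b6,b7,b8,b9,b10,b11,b12,b13,b14,b15,b16,b17,b18,b19] 1 3 4 = b8"
  "edge [b0,b1,b2,b3,b4,b5,b6,b7,b8,b9,b10,b11,b12,b13,b14,b15,b16,b17,b18,b19] 2 3 4 = b9"
  "edge [b0,b1,b2,b3,b4,b5,b6,b7,b8,b9,b10,b11,b12,b13,b14,b15,b16,b17,b18,b19] 0 1 5 = b10"
  "edge [b0,b1,b2,b3,b4,b5,b6,b7,b8,b9,b10,b11,b12,b13,b14,b15,b16,b17,b18,b19] 0 2 5 = b11"
  "edge [b0,b1,b2,b3,b4,b5,b6,b7,b8,b9,b10,b11,b12,b13,b14,b15,b16,b17,b18,b19] 1 2 5 = b12"
  "edge [b0,b1,b2,b3,b4,b5,b6,b7,b8,b9,b10,b11,b12,b13,b14,b15,b16,b17,b18,b19] 0 3 5 = b13"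
  "edge [b0,b1,b2,b3,b4,b5,b6,b7,b8,b9,b10,b11,b12,b13,b14,b15,b16,b17,b18,b19] 1 3 5 = b14"
  "edge [b0,b1,b2,b3,b4,b5,b6,b7,b8,b9,b10,b11,b12,b13,b14,b15,b16,b17,b18,b19] 2 3 5 = b15"
  "edge [b0,b1,b2,b3,b4,b5,b6,b7,b8,b9,b10,b11,b12,b13,b14,b15,b16,b17,b18,b19] 0 4 5 = b16"
  "edge [b0,b1,b2,b3,b4,b5,b6,b7,b8,b9,b10,b11,b12,b13,b14,b15,b16,b17,b18,b19] 1 4 5 = b17"
  "edge [b0,b1,b2,b3,b4,b5,b6,b7,b8,b9,b10,b11,b12,b13,b14,b15,b16,b17,b18,b19] 2 4 5 = b18"
  "edge [b0,b1,b2,b3,b4,b5,b6,b7,b8,b9,b10,b11,b12,b13,b14,b15,b16,b17,b18,b19] 3 4 5 = b19"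
  "edge [b0,b1,b2,b3,b4,b5,b6,b7,b8,b9] 0 1 2 = b0"
  "edge [b0,b1,b2,b3,b4,b5,b6,b7,b8,b9] 0 1 3 = b1"
  "edge [b0,b1,b2,b3,b4,b5,b6,b7,b8,b9] 0 2 3 = b2"
  "edge [b0,b1,b2,b3,b4,b5,b6,b7,b8,b9] 1 2 3 = b3"
  "edge [b0,b1,b2,b3,b4,b5,b6,b7,b8,b9] 0 1 4 = b4"
  "edge [b0,b1,b2,b3,b4,b5,b6,b7,b8,b9] 0 2 4 = b5"
  "edge [b0,b1,b2,b3,b4,b5,b6,b7,b8,b9] 1 2 4 = b6"
  "edge [b0,b1,b2,b3,b4,b5,b6,b7,b8,b9] 0 3 4 = b7"
  "edge [b0,b1,b2,b3,b4,b5,b6,b7,b8,b9] 1 3 4 = b8"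
  "edge [b0,b1,b2,b3,b4,b5,b6,b7,b8,b9] 2 3 4 = b9"
  by (simp_all add: edge_def triple_index_sorted choose_small [unfolded One_nat_def])

lemmas edge_list =
  edge_sorted
  edge_sorted [THEN trans [OF edge_swap12]]
  edge_sorted [THEN trans [OF edge_swap23]]
  edge_sorted [THEN trans [OF edge_swap12], THEN trans [OF edge_swap23]]
  edge_sorted [THEN trans [OF edge_swap23], THEN trans [OF edge_swap12]]
  edge_sorted [THEN trans [OF edge_swap12], THEN trans [OF edge_swap23], THEN trans [OF edge_swap12]]

lemmas numeral_neqs = simp_thms if_True if_False zero_neq_numeral numeral_neq_zero numeral_eq_iff
  num.inject num.distinct one_eq_numeral_iff numeral_eq_one_iff zero_neq_one one_neq_zero

lemmas psi_sum_20 = psi_sum_def [of "[b0,b1,b2,b3,b4,b5,b6,b7,b8,b9,b10,b11,b12,b13,b14,b15,b16,b17,b18,b19]"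
    for b0 b1 b2 b3 b4 b5 b6 b7 b8 b9 b10 b11 b12 b13 b14 b15 b16 b17 b18 b19,
  unfolded orderings_list [folded One_nat_def] list.map prod.case psi_eq sum_list.Cons sum_list.Nil, simplified edge_list]

lemmas transp_minimal_20 = transp_minimal_def [of 6 "[b0,b1,b2,b3,b4,b5,b6,b7,b8,b9,b10,b11,b12,b13,b14,b15,b16,b17,b18,b19]"
    for b0 b1 b2 b3 b4 b5 b6 b7 b8 b9 b10 b11 b12 b13 b14 b15 b16 b17 b18 b19,
  unfolded pairs_list [folded One_nat_def] triples_list [folded One_nat_def] list.map prod.case list.set ball_simps transpose_def,
  simplified numeral_neqs edge_list]

lemmas transp_minimal_10 = transp_minimal_def [of 5 "[b0,b1,b2,b3,b4,b5,b6,b7,b8,b9]"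
    for b0 b1 b2 b3 b4 b5 b6 b7 b8 b9,
  unfolded pairs_list [folded One_nat_def] triples_list [folded One_nat_def] list.map prod.case list.set ball_simps transpose_def,
  simplified numeral_neqs edge_list]

lemmas fives_ok_20 = fives_ok_def [of "[b0,b1,b2,b3,b4,b5,b6,b7,b8,b9,b10,b11,b12,b13,b14,b15,b16,b17,b18,b19]"
    for b0 b1 b2 b3 b4 b5 b6 b7 b8 b9 b10 b11 b12 b13 b14 b15 b16 b17 b18 b19,
  unfolded upt_to_6 list.set ball_simps triples_avoiding_list [folded One_nat_def] list.map prod.case,
  simplified numeral_neqs edge_list]

definition final_check :: "bool list \<Rightarrow> bool" where
  "final_check bs \<longleftrightarrow> transp_minimal 6 bs \<and> fives_ok bs \<longrightarrow> 0 \<le> psi_sum bs"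

text \<open>These are the consequences of \<open>transp_minimal 6\<close> and
  \<open>fives_ok\<close> that concern only the ten triples on the first five vertices.\<close>

definition prefix_check :: "bool list \<Rightarrow> bool" where
  "prefix_check bs \<longleftrightarrow> transp_minimal 5 bs \<and> nonedges_ok 0 bs"

text \<open>In the conditional form, evaluation stops at the first false conjunct.\<close>

lemma lazy_conj: "A \<and> B \<longleftrightarrow> (if A then B else False)"
  by simp

lemma final_check_if:
  "final_check bs = (if transp_minimal 6 bs then if fives_ok bs then 0 \<le> psi_sum bs else True else True)"
  by (simp add: final_check_def)

text \<open>
Unfolding everything symbolically for a list of 20 variables makes the evaluation of one graph cheap.
\<close>

lemmas [code] =
  final_check_if [of "[b0,b1,b2,b3,b4,b5,b6,b7,b8,b9,b10,b11,b12,b13,b14,b15,b16,b17,b18,b19]"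
    for b0 b1 b2 b3 b4 b5 b6 b7 b8 b9 b10 b11 b12 b13 b14 b15 b16 b17 b18 b19,
    unfolded transp_minimal_20 fives_ok_20 psi_sum_20 lazy_conj]
  prefix_check_def [of "[b0,b1,b2,b3,b4,b5,b6,b7,b8,b9]"
    for b0 b1 b2 b3 b4 b5 b6 b7 b8 b9,
    unfolded transp_minimal_10 lazy_conj]

text \<open>The first argument is only a unary counter.\<close>

fun extend :: "'a list \<Rightarrow> (bool list \<Rightarrow> bool) \<Rightarrow> bool list \<Rightarrow> bool" where
  "extend [] P bs = P bs"
| "extend (x # xs) P bs = (if extend xs P (bs @ [False]) then extend xs P (bs @ [True]) else False)"

text \<open>Five vertices have ten triples, and a sixth vertex adds ten more, one for each pair of
  the five.\<close>

abbreviation ten_units :: "unit list" where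
  "ten_units \<equiv> [(), (), (), (), (), (), (), (), (), ()]"

subsection \<open>Averaging over the orderings of six vertices\<close>

text \<open>The involution \<open>\<iota>\<close> exchanges the part where \<open>P\<close> holds
  with the part where it fails and preserves \<open>f\<close>, so both parts have the same
  sum.\<close>

lemma sum_involution_half:
  fixes f :: "'a \<Rightarrow> int"
  assumes fin: "finite A"
    and inv: "\<And>x. x \<in> A \<Longrightarrow> \<iota> x \<in> A" "\<And>x. x \<in> A \<Longrightarrow> \<iota> (\<iota> x) = x"
    and f: "\<And>x. x \<in> A \<Longrightarrow> f (\<iota> x) = f x"
    and P: "\<And>x. x \<in> A \<Longrightarrow> P (\<iota> x) \<longleftrightarrow> \<not> P x"
  shows "sum f A = 2 * sum f {x \<in> A. P x}"
proof -
  have "sum f {x \<in> A. \<not> P x} = sum f {x \<in> A. P x}"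
    by (rule sum.reindex_bij_witness [of _ \<iota> \<iota>]) (use inv f P in auto)
  moreover have "sum f A = sum f {x \<in> A. P x} + sum f {x \<in> A. \<not> P x}"
    by (subst sum.union_disjoint [symmetric]) (use fin in \<open>auto intro: sum.cong\<close>)
  ultimately show ?thesis by simp
qed

lemma less_iff_not_less: "a \<noteq> b \<Longrightarrow> b < a \<longleftrightarrow> \<not> a < (b :: nat)"
  by auto

lemma set_concat_mapI: "x \<in> set xs \<Longrightarrow> y \<in> set (f x) \<Longrightarrow> y \<in> set (concat (map f xs))"
  by auto

lemma set_ifI: "P \<Longrightarrow> y \<in> set xs \<Longrightarrow> y \<in> set (if P then xs else ys)"
  by simp

text \<open>One inclusion is a check of the listed tuples; the other follows the list comprehension
  and supplies one value per generator.\<close>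

lemma set_orderings: "set orderings =
  {(u, v, a, b, c, d). distinct [u, v, a, b, c, d] \<and> {u, v, a, b, c, d} \<subseteq> {..<6} \<and> u < v \<and> a < b \<and> c < d \<and> a < c}"
  (is "_ = ?R")
proof
  have "list_all (\<lambda>(u, v, a, b, c, d). distinct [u, v, a, b, c, d] \<and> u < 6 \<and> v < 6 \<and> a < 6 \<and> b < 6 \<and>
      c < 6 \<and> d < 6 \<and> u < v \<and> a < b \<and> c < d \<and> a < c) orderings"
    by (simp add: orderings_list)
  note * = this [unfolded list_all_iff]
  show "set orderings \<subseteq> ?R"
  proof
    fix x assume "x \<in> set orderings"
    from bspec [OF * this] show "x \<in> ?R" by (cases x) simp
  qed
next
  show "?R \<subseteq> set orderings"
  proof clarify
    fix u v a b c d :: nat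
    assume *: "distinct [u, v, a, b, c, d]" "{u, v, a, b, c, d} \<subseteq> {..<6}" "u < v" "a < b" "c < d" "a < c"
    show "(u, v, a, b, c, d) \<in> set orderings"
      unfolding orderings_def
      apply (rule set_concat_mapI [of u], use * in simp)
      apply (rule set_concat_mapI [of v], use * in simp)
      apply (rule set_ifI, use * in fastforce)
      apply (rule set_concat_mapI [of a], use * in simp)
      apply (rule set_ifI, use * in fastforce)
      apply (rule set_concat_mapI [of b], use * in simp)
      apply (rule set_ifI, use * in fastforce)
      apply (rule set_concat_mapI [of c], use * in simp)
      apply (rule set_ifI, use * in fastforce)
      apply (rule set_concat_mapI [of d], use * in simp)
      apply (rule set_ifI, use * in fastforce)
      apply simp
      done
  qed
qed
text \<open>The factor 16 comes from four successive halvings: swapping \<open>u\<close> and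
  \<open>v\<close>, \<open>a\<close> and \<open>b\<close>, \<open>c\<close> and \<open>d\<close>,
  and finally the two pairs. Each lets one more of the comparisons \<open>u < v\<close>,
  \<open>a < b\<close>, \<open>c < d\<close>, \<open>a < c\<close> be imposed.\<close>

lemma sum_permutations_6:
  fixes f :: "nat \<Rightarrow> nat \<Rightarrow> nat \<Rightarrow> nat \<Rightarrow> nat \<Rightarrow> nat \<Rightarrow> int"
  assumes f1: "\<And>u v a b c d. f v u a b c d = f u v a b c d"
    and f2: "\<And>u v a b c d. f u v b a c d = f u v a b c d"
    and f3: "\<And>u v a b c d. f u v c d a b = f u v a b c d"
  shows "(\<Sum>p\<in>permutations_of_set {..<6}. f (p ! 0) (p ! 1) (p ! 2) (p ! 3) (p ! 4) (p ! 5)) =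
    16 * (\<Sum>(u, v, a, b, c, d) \<leftarrow> orderings. f u v a b c d)"
proof -
  \<comment> \<open>The swap of \<open>c\<close> and \<open>d\<close> is the swap of
    \<open>a\<close> and \<open>b\<close> conjugated by the exchange of the two pairs.\<close>
  have f4: "f u v a b d c = f u v a b c d" for u v a b c d
    using f2 [of u v d c a b] f3 [of u v a b c d] f3 [of u v a b d c] by simp
  define g where "g = (\<lambda>(u, v, a, b, c, d). f u v a b c d)"
  define h where "h = (\<lambda>(u, v, a, b, c, d). [u, v, a, b, c, d :: nat])"
  define T where "T = {(u, v, a, b, c, d). distinct [u, v, a, b, c, d] \<and> set [u, v, a, b, c, d] \<subseteq> {..<6::nat}}"
  define T1 where "T1 = {x \<in> T. case x of (u, v, a, b, c, d) \<Rightarrow> u < v}"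
  define T2 where "T2 = {x \<in> T1. case x of (u, v, a, b, c, d) \<Rightarrow> a < b}"
  define T3 where "T3 = {x \<in> T2. case x of (u, v, a, b, c, d) \<Rightarrow> c < d}"
  define T4 where "T4 = {x \<in> T3. case x of (u, v, a, b, c, d) \<Rightarrow> a < c}"
  have perm: "permutations_of_set {..<6} = h ` T"
  proof (intro equalityI subsetI)
    fix p assume "p \<in> permutations_of_set {..<6::nat}"
    then have p: "distinct p" "set p = {..<6}" "length p = 6"
      using length_finite_permutations_of_set [of p] by (simp_all add: permutations_of_set_def)
    from p(3) obtain u v a b c d where "p = [u, v, a, b, c, d]"
      by (auto simp: numeral_eq_Suc length_Suc_conv)
    then show "p \<in> h ` T"
      using p(1) equalityD1 [OF p(2)] by (intro image_eqI [where x = "(u, v, a, b, c, d)"]) (simp_all add: T_def h_def)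
  next
    fix p assume "p \<in> h ` T"
    then have p: "distinct p" "set p \<subseteq> {..<6}" "length p = 6"
      by (auto simp: T_def h_def)
    then have "set p = {..<6}"
      by (intro card_subset_eq) (auto simp: distinct_card)
    with p show "p \<in> permutations_of_set {..<6}" by auto
  qed
  have fin: "finite T"
    by (rule finite_subset [of _ "{..<6} \<times> {..<6} \<times> {..<6} \<times> {..<6} \<times> {..<6} \<times> {..<6}"]) (auto simp: T_def)
  then have fins: "finite T1" "finite T2" "finite T3"
    by (simp_all add: T1_def T2_def T3_def)
  have inj: "inj_on h T" by (auto simp: inj_on_def h_def)
  have "(\<Sum>p\<in>permutations_of_set {..<6}. f (p ! 0) (p ! 1) (p ! 2) (p ! 3) (p ! 4) (p ! 5)) = sum g T"
    unfolding perm sum.reindex [OF inj] by (intro sum.cong) (auto simp: g_def h_def)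
  also have "sum g T = 2 * sum g T1"
    unfolding T1_def
    by (rule sum_involution_half [OF fin, where \<iota> = "\<lambda>(u, v, a, b, c, d). (v, u, a, b, c, d)"])
       (clarsimp simp: T_def g_def f1; (intro less_iff_not_less)?; simp)+
  also have "sum g T1 = 2 * sum g T2"
    unfolding T2_def
    by (rule sum_involution_half [OF fins(1), where \<iota> = "\<lambda>(u, v, a, b, c, d). (u, v, b, a, c, d)"])
       (clarsimp simp: T1_def T_def g_def f2; (intro less_iff_not_less)?; simp)+
  also have "sum g T2 = 2 * sum g T3"
    unfolding T3_def
    by (rule sum_involution_half [OF fins(2), where \<iota> = "\<lambda>(u, v, a, b, c, d). (u, v, a, b, d, c)"])
       (clarsimp simp: T2_def T1_def T_def g_def f4; (intro less_iff_not_less)?; simp)+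
  \<comment> \<open>Exchanging the pairs keeps both of them sorted, so the involution stays inside
    \<open>T3\<close> and reverses only the comparison of \<open>a\<close> with
    \<open>c\<close>.\<close>
  also have "sum g T3 = 2 * sum g T4"
    unfolding T4_def
    by (rule sum_involution_half [OF fins(3), where \<iota> = "\<lambda>(u, v, a, b, c, d). (u, v, c, d, a, b)"])
       (clarsimp simp: T3_def T2_def T1_def T_def g_def f3; (intro less_iff_not_less)?; simp)+
  also have "T4 = set orderings"
    unfolding set_orderings T4_def T3_def T2_def T1_def T_def by auto
  also have "sum g (set orderings) = (\<Sum>(u, v, a, b, c, d) \<leftarrow> orderings. f u v a b c d)"
    by (subst sum_list_distinct_conv_sum_set) (simp_all add: orderings_list g_def)
  finally show ?thesis by simp
qed

section \<open>Symmetries of the certificate and its transfer to bit lists\<close>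

lemma phi_tab_swap: "phi_tab q p r s = phi_tab p q r s" "phi_tab p q s r = phi_tab p q r s"
  by (cases p; cases q; cases r; cases s; simp)+

lemma omega_tab_swap: "omega_tab q p r s = omega_tab p q r s" "omega_tab p q s r = - omega_tab p q r s"
  by (cases p; cases q; cases r; cases s; simp)+

lemma delta_tab_swap: "delta_tab p q w t s r = delta_tab p q r s t w" "delta_tab q p r s w t = - delta_tab p q r s t w"
  by (cases p; cases q; cases r; cases s; cases t; cases w; simp)+

definition bits :: "('a \<Rightarrow> 'a \<Rightarrow> 'a \<Rightarrow> bool) \<Rightarrow> 'a list \<Rightarrow> bool list" where
  "bits E xs = map (\<lambda>(i, j, k). E (xs ! i) (xs ! j) (xs ! k)) (triples 6)"

lemma bits_list: "bits E xs =
  [E (xs ! 0) (xs ! 1) (xs ! 2), E (xs ! 0) (xs ! 1) (xs ! 3), E (xs ! 0) (xs ! 2) (xs ! 3), E (xs ! 1) (xs ! 2) (xs ! 3),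
   E (xs ! 0) (xs ! 1) (xs ! 4), E (xs ! 0) (xs ! 2) (xs ! 4), E (xs ! 1) (xs ! 2) (xs ! 4), E (xs ! 0) (xs ! 3) (xs ! 4),
   E (xs ! 1) (xs ! 3) (xs ! 4), E (xs ! 2) (xs ! 3) (xs ! 4),
   E (xs ! 0) (xs ! 1) (xs ! 5), E (xs ! 0) (xs ! 2) (xs ! 5), E (xs ! 1) (xs ! 2) (xs ! 5), E (xs ! 0) (xs ! 3) (xs ! 5),
   E (xs ! 1) (xs ! 3) (xs ! 5), E (xs ! 2) (xs ! 3) (xs ! 5), E (xs ! 0) (xs ! 4) (xs ! 5), E (xs ! 1) (xs ! 4) (xs ! 5),
   E (xs ! 2) (xs ! 4) (xs ! 5), E (xs ! 3) (xs ! 4) (xs ! 5)]"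
  by (simp add: bits_def triples_list)

lemma lex_le_iff: "length bs = length cs \<Longrightarrow> lex_le bs cs \<longleftrightarrow> bs \<le> cs"
proof (induction bs cs rule: list_induct2)
  case (Cons b bs c cs)
  then show ?case by (cases b; cases c; simp)
qed simp

lemma length_triples_6: "length (triples 6) = 20"
  by (simp add: triples_list)

context
  fixes E :: "'a \<Rightarrow> 'a \<Rightarrow> 'a \<Rightarrow> bool"
  assumes E12: "\<And>x y z. E x y z \<longleftrightarrow> E y x z"
    and E23: "\<And>x y z. E x y z \<longleftrightarrow> E x z y"
begin

lemma phi_swap: "phi E v u a b = phi E u v a b" "phi E u v b a = phi E u v a b"
  using phi_tab_swap [of "E u v b" "E u v a" "E u a b" "E v a b"]
    phi_tab_swap [of "E u v b" "E u v a" "E v a b" "E u a b"]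
    E12 [of u v a] E12 [of u v b] E23 [of u a b] E23 [of v a b]
  by (simp_all add: phi_def)

lemma omega_swap: "omega E v u a b = - omega E u v a b" "omega E u v b a = omega E u v a b"
  using omega_tab_swap [of "E u v b" "E u v a" "E u a b" "E v a b"]
    omega_tab_swap [of "E u v b" "E u v a" "E v a b" "E u a b"]
    E12 [of u v a] E12 [of u v b] E23 [of u a b] E23 [of v a b]
  by (simp_all add: omega_def)

lemma delta_swap: "delta E b a c d x = delta E a b c d x" "delta E c d a b x = - delta E a b c d x"
proof -
  have K: "E b a c \<and> E b a d \<and> E b c d \<and> E a c d \<longleftrightarrow> E a b c \<and> E a b d \<and> E a c d \<and> E b c d"
    "E c d a \<and> E c d b \<and> E c a b \<and> E d a b \<longleftrightarrow> E a b c \<and> E a b d \<and> E a c d \<and> E b c d"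
    by (simp_all add: E12 E23 conj_ac)
  have x: "E x b a = E x a b" "E x c a = E x a c" "E x d b = E x b d" "E x c b = E x b c" "E x d a = E x a d"
    by (rule E23)+
  show "delta E b a c d x = delta E a b c d x"
    unfolding delta_def K(1) x(1)
    by (intro if_cong refl delta_tab_swap(1))
  show "delta E c d a b x = - delta E a b c d x"
    unfolding delta_def K(2) x(2-) delta_tab_swap(2) [of "E x c d" "E x a b"]
    by simp
qed

text \<open>\<open>omega\<close> changes sign when \<open>u\<close> and \<open>v\<close> are
  swapped, and \<open>delta\<close> when the two pairs are exchanged. Each occurs in a product of
  two factors that change sign together, so the signs cancel.\<close>

lemma psi_swap:
  "psi E v u a b c d = psi E u v a b c d"
  "psi E u v b a c d = psi E u v a b c d"
  "psi E u v c d a b = psi E u v a b c d"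
  unfolding psi_def
    phi_swap(1) [of v u] omega_swap(1) [of v u] E12 [of v u]
    phi_swap(2) [of u v b a] omega_swap(2) [of u v b a] delta_swap(1) [of b a]
    delta_swap(2) [of c d a b]
  by (simp_all add: algebra_simps)

text \<open>Both sides are symmetric, so sorted indices suffice. Distinctness matters because
  \<open>triple_index\<close> locates no triple when indices repeat.\<close>

lemma edge_bits:
  assumes "i < 6" "j < 6" "k < 6" "distinct [i, j, k]"
  shows "edge (bits E xs) i j k \<longleftrightarrow> E (xs ! i) (xs ! j) (xs ! k)"
proof -
  have *: "edge (bits E xs) i j k \<longleftrightarrow> E (xs ! i) (xs ! j) (xs ! k)" if "i < j" "j < k" "k < 6" for i j k
  proof -
    have "(i, j, k) \<in> set (triples 6)"
      using that by (auto simp: triples_def image_iff)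
    then show ?thesis
      unfolding bits_list triples_list by (auto simp: edge_sorted [unfolded One_nat_def])
  qed
  consider "i < j" "j < k" | "i < k" "k < j" | "j < i" "i < k" | "j < k" "k < i" | "k < i" "i < j" | "k < j" "j < i"
    using assms(4) by fastforce
  then show ?thesis
  proof cases
    case 1 then show ?thesis using * assms by blast
  next
    case 2 then show ?thesis using * [of i k j] assms edge_swap23 E23 by metis
  next
    case 3 then show ?thesis using * [of j i k] assms edge_swap12 E12 by metis
  next
    case 4 then show ?thesis using * [of j k i] assms edge_swap12 edge_swap23 E12 E23 by metis
  next
    case 5 then show ?thesis using * [of k i j] assms edge_swap12 edge_swap23 E12 E23 by metis
  next
    case 6 then show ?thesis using * [of k j i] assms edge_swap12 edge_swap23 E12 E23 by metis
  qed
qed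

lemma psi_bits:
  assumes "distinct [u, v, a, b, c, d]" "{u, v, a, b, c, d} \<subseteq> {..<6}"
  shows "psi (edge (bits E xs)) u v a b c d = psi E (xs ! u) (xs ! v) (xs ! a) (xs ! b) (xs ! c) (xs ! d)"
  using assms by (simp add: psi_def phi_def omega_def delta_def edge_bits)

text \<open>Replacing vertices by their positions in \<open>xs\<close> turns the orderings of the
  six-set into permutations of \<open>{..<6}\<close>, whose sum reduces to the representatives in
  \<open>orderings\<close>.\<close>

lemma sum_psi_permutations:
  assumes xs: "distinct xs" "length xs = 6"
  shows "(\<Sum>ys\<in>permutations_of_set (set xs). psi E (ys ! 0) (ys ! 1) (ys ! 2) (ys ! 3) (ys ! 4) (ys ! 5)) =
    16 * psi_sum (bits E xs)"
proof -
  have inj: "inj_on ((!) xs) {..<6}"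
    using xs by (simp add: inj_on_def nth_eq_iff_index_eq)
  have set: "set xs = (!) xs ` {..<6}"
    using xs by (auto simp: set_conv_nth)
  have len: "length p = 6" if "p \<in> permutations_of_set {..<6::nat}" for p
    using length_finite_permutations_of_set [OF that] by simp
  have inj_map: "inj_on (map ((!) xs)) (permutations_of_set {..<6})"
    using inj by (intro inj_onI) (metis inj_on_map_eq_map permutations_of_setD(1) sup.idem)
  have "(\<Sum>ys\<in>permutations_of_set (set xs). psi E (ys ! 0) (ys ! 1) (ys ! 2) (ys ! 3) (ys ! 4) (ys ! 5)) =
    (\<Sum>p\<in>permutations_of_set {..<6}. psi E (xs ! (p ! 0)) (xs ! (p ! 1)) (xs ! (p ! 2)) (xs ! (p ! 3)) (xs ! (p ! 4)) (xs ! (p ! 5)))"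
    unfolding set permutations_of_set_image_inj [OF inj] sum.reindex [OF inj_map]
    by (intro sum.cong) (auto simp: len)
  also have "\<dots> = 16 * (\<Sum>(u, v, a, b, c, d) \<leftarrow> orderings. psi E (xs ! u) (xs ! v) (xs ! a) (xs ! b) (xs ! c) (xs ! d))"
    by (rule sum_permutations_6) (rule psi_swap)+
  also have "(\<Sum>(u, v, a, b, c, d) \<leftarrow> orderings. psi E (xs ! u) (xs ! v) (xs ! a) (xs ! b) (xs ! c) (xs ! d)) = psi_sum (bits E xs)"
    unfolding psi_sum_def
  proof (intro arg_cong [where f = sum_list] map_cong refl)
    fix t assume "t \<in> set orderings"
    moreover obtain u v a b c d where t: "t = (u, v, a, b, c, d)" by (cases t)
    ultimately have "distinct [u, v, a, b, c, d]" "{u, v, a, b, c, d} \<subseteq> {..<6}"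
      unfolding set_orderings by simp_all
    with t show "(case t of (u, v, a, b, c, d) \<Rightarrow> psi E (xs ! u) (xs ! v) (xs ! a) (xs ! b) (xs ! c) (xs ! d)) =
      (case t of (u, v, a, b, c, d) \<Rightarrow> psi (edge (bits E xs)) u v a b c d)"
      by (simp add: psi_bits)
  qed
  finally show ?thesis .
qed

text \<open>The relabelled list that \<open>transp_minimal\<close> compares with is thus itself the
  encoding of another ordering of the same vertices.\<close>

lemma bits_transpose:
  assumes "a < 6" "b < 6"
  shows "map (\<lambda>(i, j, k). edge (bits E xs) (transpose a b i) (transpose a b j) (transpose a b k)) (triples 6) =
    bits E (map (\<lambda>i. xs ! transpose a b i) [0..<6])"
  unfolding bits_def [of E "map _ _"]
proof (intro map_cong refl, clarify)
  fix i j k assume "(i, j, k) \<in> set (triples 6)"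
  then have ijk: "i < j" "j < k" "k < 6" by (auto simp: triples_def)
  have lt: "transpose a b i < 6" if "i < 6" for i
    using assms that by (simp add: transpose_def)
  show "edge (bits E xs) (transpose a b i) (transpose a b j) (transpose a b k) \<longleftrightarrow>
    E (map (\<lambda>i. xs ! transpose a b i) [0..<6] ! i) (map (\<lambda>i. xs ! transpose a b i) [0..<6] ! j)
      (map (\<lambda>i. xs ! transpose a b i) [0..<6] ! k)"
    by (subst edge_bits) (use ijk lt in \<open>auto simp: inj_eq [OF bij_is_inj [OF bij_transpose]]\<close>)
qed

text \<open>An ordering of \<open>S\<close> whose encoding is lexicographically least among all 720
  orderings cannot be improved by a transposition.\<close>

lemma ex_transp_minimal:
  assumes "card S = 6"
  obtains xs where "distinct xs" "set xs = S" "length xs = 6" "transp_minimal 6 (bits E xs)"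
proof -
  have "finite S" using assms card.infinite by fastforce
  then have "finite (bits E ` permutations_of_set S)" "bits E ` permutations_of_set S \<noteq> {}"
    by simp_all
  then have "Min (bits E ` permutations_of_set S) \<in> bits E ` permutations_of_set S"
    by (rule Min_in)
  then obtain xs where xs: "xs \<in> permutations_of_set S" "bits E xs = Min (bits E ` permutations_of_set S)"
    by (metis imageE)
  have len: "length xs = 6"
    using xs(1) length_finite_permutations_of_set assms by metis
  have "lex_le (bits E xs) (map (\<lambda>(i, j, k). edge (bits E xs) (transpose a b i) (transpose a b j) (transpose a b k)) (triples 6))"
    if "(a, b) \<in> set (pairs 6)" for a b
  proof -
    have ab: "a < 6" "b < 6" using that by (auto simp: pairs_def)
    \<comment> \<open>Transposing two positions gives another ordering of \<open>S\<close>, which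
      takes part in the minimum.\<close>
    have "transpose a b permutes {0..<6}" using ab by (intro permutes_swap_id) auto
    then have "mset (map (transpose a b) [0..<6]) = mset [0..<6]"
      by (simp only: mset_map mset_upt permutes_image_mset)
    then have "mset (map ((!) xs) (map (transpose a b) [0..<6])) = mset (map ((!) xs) [0..<6])"
      by (metis mset_map)
    also have "map ((!) xs) [0..<6] = xs" using len map_nth [of xs] by simp
    finally have "mset (map (\<lambda>i. xs ! transpose a b i) [0..<6]) = mset xs" by (simp add: comp_def)
    then have "map (\<lambda>i. xs ! transpose a b i) [0..<6] \<in> permutations_of_set S"
      using xs(1) by (metis mset_eq_setD mset_eq_imp_distinct_iff permutations_of_setD permutations_of_setI)
    then have "bits E xs \<le> bits E (map (\<lambda>i. xs ! transpose a b i) [0..<6])"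
      using xs(2) \<open>finite (bits E ` permutations_of_set S)\<close> by simp
    then show ?thesis
      unfolding bits_transpose [OF ab] by (subst lex_le_iff) (simp_all add: bits_def)
  qed
  then have "transp_minimal 6 (bits E xs)"
    unfolding transp_minimal_def by blast
  then show ?thesis
    using xs(1) len that permutations_of_setD by metis
qed

end

section \<open>The exhaustive search over 3-graphs on six vertices\<close>

lemma extend_imp:
  "extend us P bs \<Longrightarrow> length cs = length us \<Longrightarrow> P (bs @ cs)"
proof (induction us arbitrary: bs cs)
  case (Cons u us)
  then obtain c cs' where cs: "cs = c # cs'" "length cs' = length us"
    by (auto simp: length_Suc_conv)
  have "extend us P (bs @ [c])"
    using Cons.prems(1) by (cases c) (auto split: if_splits)
  from Cons.IH [OF this cs(2)] show ?case by (simp add: cs)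
qed simp

text \<open>The search has two levels: the first ten bits fix the 3-graph on vertices 0 to 4, and
  only those passing \<open>prefix_check\<close> are extended by the ten triples through vertex
  5.\<close>

lemma all_checks: "extend ten_units (\<lambda>bs. if prefix_check bs then extend ten_units final_check bs else True) []"
  by code_simp

lemma lex_le_take: "lex_le bs cs \<Longrightarrow> lex_le (take n bs) (take n cs)"
  by (induction bs cs arbitrary: n rule: lex_le.induct) (auto simp: take_Cons split: nat.splits)

lemma lex_le_take_10:
  assumes "lex_le (a0 # a1 # a2 # a3 # a4 # a5 # a6 # a7 # a8 # a9 # as)
    (c0 # c1 # c2 # c3 # c4 # c5 # c6 # c7 # c8 # c9 # cs)"
  shows "lex_le [a0, a1, a2, a3, a4, a5, a6, a7, a8, a9] [c0, c1, c2, c3, c4, c5, c6, c7, c8, c9]"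
  using lex_le_take [OF assms, of 10] by simp

lemma length_10E:
  assumes "length bs = 10"
  obtains b0 b1 b2 b3 b4 b5 b6 b7 b8 b9 where "bs = [b0, b1, b2, b3, b4, b5, b6, b7, b8, b9]"
  using assms by (auto simp: numeral_eq_Suc length_Suc_conv)

lemma psi_sum_nonneg:
  assumes "length bs = 20" "transp_minimal 6 bs" "fives_ok bs"
  shows "0 \<le> psi_sum bs"
proof -
  have len: "length (take 10 bs) = 10" "length (drop 10 bs) = 10"
    using assms(1) by simp_all
  obtain b0 b1 b2 b3 b4 b5 b6 b7 b8 b9 where 1: "take 10 bs = [b0, b1, b2, b3, b4, b5, b6, b7, b8, b9]"
    using length_10E [OF len(1)] .
  obtain b10 b11 b12 b13 b14 b15 b16 b17 b18 b19
    where 2: "drop 10 bs = [b10, b11, b12, b13, b14, b15, b16, b17, b18, b19]"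
    using length_10E [OF len(2)] .
  have bs: "bs = [b0, b1, b2, b3, b4, b5, b6, b7, b8, b9, b10, b11, b12, b13, b14, b15, b16, b17, b18, b19]"
    using append_take_drop_id [of 10 bs] unfolding 1 2 by simp
  have "prefix_check (take 10 bs)"
    unfolding 1 prefix_check_def
  proof
    \<comment> \<open>This is the condition of \<open>fives_ok\<close> for the five-set that omits
      vertex 5.\<close>
    show "nonedges_ok 0 [b0, b1, b2, b3, b4, b5, b6, b7, b8, b9]"
      using assms(3) unfolding bs fives_ok_20 by blast
    \<comment> \<open>A transposition of two of the first five vertices permutes the first ten
      triples among themselves, so each comparison of 20 bits truncates to one of the comparisons
      for five vertices.\<close>
    show "transp_minimal 5 [b0, b1, b2, b3, b4, b5, b6, b7, b8, b9]"
      using assms(2) unfolding bs transp_minimal_20 transp_minimal_10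
      by (elim conjE, intro conjI) (erule lex_le_take_10)+
  qed
  then have "extend ten_units final_check (take 10 bs)"
    using extend_imp [OF all_checks, of "take 10 bs"] len(1) by simp
  from extend_imp [OF this, of "drop 10 bs"] len(2) have "final_check bs"
    by simp
  then show ?thesis
    using assms(2,3) by (simp add: final_check_def)
qed


section \<open>From admissible 3-graphs to the encoded five-vertex conditions\<close>

lemma nonedges_ok_iff: "nonedges_ok m bs \<longleftrightarrow> m + length (filter Not bs) \<noteq> 0 \<and> m + length (filter Not bs) \<noteq> 2"
  by (induction m bs rule: nonedges_ok.induct) auto

lemma set_triples: "set (triples n) = {(i, j, k). i < j \<and> j < k \<and> k < n}"
  by (auto simp: triples_def image_iff)

text \<open>A three-element set determines its minimum, its maximum and its sum, hence the sorted
  triple.\<close>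

lemma inj_on_triple_set: "inj_on (\<lambda>(i, j, k). {i, j, k}) {(i, j, k :: nat). i < j \<and> j < k}"
proof (rule inj_onI)
  fix s t :: "nat \<times> nat \<times> nat"
  obtain i j k i' j' k' where st: "s = (i, j, k)" "t = (i', j', k')" by (metis prod_cases3)
  assume "s \<in> {(i, j, k). i < j \<and> j < k}" "t \<in> {(i, j, k). i < j \<and> j < k}"
    "(\<lambda>(i, j, k). {i, j, k}) s = (\<lambda>(i, j, k). {i, j, k}) t"
  then have lt: "i < j" "j < k" "i' < j'" "j' < k'" and eq: "{i, j, k} = {i', j', k'}"
    unfolding st by simp_all
  have *: "Min {i, j, k} = i \<and> Max {i, j, k} = k \<and> \<Sum>{i, j, k} = i + j + k"
    if "i < j" "j < k" for i j k :: nat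
    using that by simp
  have "i = i'" "k = k'" "i + j + k = i' + j' + k'"
    using * [OF lt(1,2)] * [OF lt(3,4)] unfolding eq by (metis, metis, metis)
  then show "s = t" by (simp add: st)
qed

lemma length_triples_avoiding: "x < 6 \<Longrightarrow> length (triples_avoiding x) = 10"
proof -
  assume "x < 6"
  then have "x = 0 \<or> x = 1 \<or> x = 2 \<or> x = 3 \<or> x = 4 \<or> x = 5" by linarith
  then show ?thesis by (elim disjE) (simp_all add: triples_avoiding_list [unfolded One_nat_def])
qed

text \<open>The listed index triples give ten distinct 3-subsets of the remaining five vertices.
  Since \<open>5 choose 3\<close> is 10, these are all of them, each listed once.\<close>

lemma count_edges_avoiding:
  assumes xs: "distinct xs" "length xs = 6" "x < 6" and F: "\<And>e. e \<in> F \<Longrightarrow> card e = 3"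
  shows "length (filter (\<lambda>(i, j, k). {xs ! i, xs ! j, xs ! k} \<in> F) (triples_avoiding x)) =
    card {e \<in> F. e \<subseteq> set xs - {xs ! x}}"
proof -
  define S where "S = set xs - {xs ! x}"
  define es where "es = map (\<lambda>(i, j, k). {xs ! i, xs ! j, xs ! k}) (triples_avoiding x)"
  have inj: "inj_on ((!) xs) {..<6}"
    using xs by (simp add: inj_on_def nth_eq_iff_index_eq)
  have mem: "(i, j, k) \<in> set (triples_avoiding x) \<longleftrightarrow> i < j \<and> j < k \<and> k < 6 \<and> x \<notin> {i, j, k}" for i j k
    by (auto simp: triples_avoiding_def set_triples)
  have "card S = 5"
    unfolding S_def using xs by (simp add: distinct_card)
  have "distinct es"
  proof -
    have "inj_on (\<lambda>T. (!) xs ` T) (Pow {..<6})"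
      using inj by (rule inj_on_image_Pow)
    then have "inj_on ((\<lambda>T. (!) xs ` T) \<circ> (\<lambda>(i, j, k). {i, j, k})) (set (triples_avoiding x))"
      by (intro comp_inj_on inj_on_subset [OF inj_on_triple_set])
         (auto simp: mem elim!: inj_on_subset)
    moreover have "(\<lambda>T. (!) xs ` T) \<circ> (\<lambda>(i, j, k). {i, j, k}) = (\<lambda>(i, j, k). {xs ! i, xs ! j, xs ! k})"
      by auto
    moreover have "distinct (triples_avoiding x)"
      by (simp add: triples_avoiding_def triples_list)
    ultimately show ?thesis
      by (simp add: es_def distinct_map)
  qed
  have "set es \<subseteq> {e. e \<subseteq> S \<and> card e = 3}"
  proof
    fix e assume "e \<in> set es"
    then obtain i j k where ijk: "i < j" "j < k" "k < 6" "x \<notin> {i, j, k}" and e: "e = {xs ! i, xs ! j, xs ! k}"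
      unfolding es_def by (auto simp: mem)
    have "card e = card {i, j, k}"
      using card_image [OF inj_on_subset [OF inj, of "{i, j, k}"]] ijk by (simp add: e)
    moreover have "e \<subseteq> S"
      using ijk xs by (auto simp: e S_def nth_eq_iff_index_eq)
    ultimately show "e \<in> {e. e \<subseteq> S \<and> card e = 3}"
      using ijk by simp
  qed
  moreover have "card (set es) = card {e. e \<subseteq> S \<and> card e = 3}"
  proof -
    have "card (set es) = 10"
      using distinct_card [OF \<open>distinct es\<close>] length_triples_avoiding [OF xs(3)] by (simp add: es_def)
    moreover have "card {e. e \<subseteq> S \<and> card e = 3} = 5 choose 3"
      using n_subsets [of S 3] \<open>card S = 5\<close> by (simp add: S_def)
    ultimately show ?thesis by (simp add: choose_small)
  qed
  moreover have "finite {e. e \<subseteq> S \<and> card e = 3}"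
    by (simp add: S_def)
  ultimately have set_es: "set es = {e. e \<subseteq> S \<and> card e = 3}"
    by (intro card_subset_eq)
  have "length (filter (\<lambda>(i, j, k). {xs ! i, xs ! j, xs ! k} \<in> F) (triples_avoiding x)) =
      length (filter (\<lambda>e. e \<in> F) es)"
    unfolding es_def by (simp add: filter_map comp_def case_prod_unfold)
  also have "\<dots> = card (set (filter (\<lambda>e. e \<in> F) es))"
    by (intro distinct_card [symmetric] distinct_filter \<open>distinct es\<close>)
  also have "set (filter (\<lambda>e. e \<in> F) es) = {e \<in> F. e \<subseteq> S}"
    using F by (auto simp: set_es)
  finally show ?thesis by (simp add: S_def)
qed

text \<open>Ten edges inside a five-set are all of its triples, so any bijection from
  \<open>{..<5}\<close> onto it is a copy of \<open>K5\<close>.\<close>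

lemma contains_K5I:
  assumes S: "S \<subseteq> V" "card S = 5" and F: "\<And>e. e \<in> F \<Longrightarrow> card e = 3" and "card {e \<in> F. e \<subseteq> S} = 10"
  shows "contains_K5 V F"
proof -
  have fin: "finite S" using S(2) card.infinite by fastforce
  have "card {e. e \<subseteq> S \<and> card e = 3} = 10"
    using n_subsets [OF fin, of 3] S(2) by (simp add: choose_small)
  then have all: "{e \<in> F. e \<subseteq> S} = {e. e \<subseteq> S \<and> card e = 3}"
    using F assms(4) fin by (intro card_subset_eq) auto
  obtain f where f: "bij_betw f {..<5::nat} S"
    using ex_bij_betw_nat_finite [OF fin] S(2) by (auto simp: atLeast0LessThan)
  have "f ` e \<in> F" if "e \<in> complete_edges {..<5}" for e
  proof -
    have e: "e \<subseteq> {..<5}" "card e = 3" using that by (auto simp: complete_edges_def)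
    then have "card (f ` e) = 3"
      using f by (metis bij_betw_def card_image inj_on_subset)
    moreover have "f ` e \<subseteq> S" using f e(1) by (auto simp: bij_betw_def)
    ultimately show ?thesis using all by blast
  qed
  then show ?thesis
    using f S(1) unfolding contains_K5_def contains_copy_def
    by (intro exI [of _ f]) (auto simp: bij_betw_def)
qed

definition adj :: "'a set set \<Rightarrow> 'a \<Rightarrow> 'a \<Rightarrow> 'a \<Rightarrow> bool" where
  "adj F x y z \<longleftrightarrow> {x, y, z} \<in> F"

lemma adj_swap: "adj F x y z = adj F y x z" "adj F x y z = adj F x z y"
  by (simp_all add: adj_def insert_commute)

lemma fives_ok_bits:
  assumes "admissible V F" "distinct xs" "length xs = 6" "set xs \<subseteq> V"
  shows "fives_ok (bits (adj F) xs)"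
proof -
  have F: "\<And>e. e \<in> F \<Longrightarrow> card e = 3" and K5: "\<not> contains_K5 V F"
    and 8: "\<And>S. S \<subseteq> V \<Longrightarrow> card S = 5 \<Longrightarrow> card {e \<in> F. e \<subseteq> S} \<noteq> 8"
    using assms(1) by (auto simp: admissible_def three_graph_def spans_def)
  have "nonedges_ok 0 (map (\<lambda>(i, j, k). edge (bits (adj F) xs) i j k) (triples_avoiding x))" if x: "x < 6" for x
  proof -
    have eq: "map (\<lambda>(i, j, k). edge (bits (adj F) xs) i j k) (triples_avoiding x) =
        map (\<lambda>(i, j, k). {xs ! i, xs ! j, xs ! k} \<in> F) (triples_avoiding x)" (is "?l = ?r")
    proof (intro map_cong refl, clarify)
      fix i j k assume "(i, j, k) \<in> set (triples_avoiding x)"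
      then have "i < j" "j < k" "k < 6"
        by (auto simp: triples_avoiding_def set_triples)
      then show "edge (bits (adj F) xs) i j k \<longleftrightarrow> {xs ! i, xs ! j, xs ! k} \<in> F"
        by (subst edge_bits [OF adj_swap]) (auto simp: adj_def)
    qed
    have S: "set xs - {xs ! x} \<subseteq> V" "card (set xs - {xs ! x}) = 5"
      using assms x by (auto simp: distinct_card)
    have "length (filter id ?r) = card {e \<in> F. e \<subseteq> set xs - {xs ! x}}"
      using count_edges_avoiding [OF assms(2,3) x, of F] F
      by (simp add: filter_map comp_def case_prod_unfold)
    moreover have "length (filter id ?r) + length (filter Not ?r) = 10"
      using sum_length_filter_compl [of id ?r] length_triples_avoiding [OF x] by simp
    moreover have "card {e \<in> F. e \<subseteq> set xs - {xs ! x}} \<noteq> 8"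
      using 8 [OF S] .
    moreover have "card {e \<in> F. e \<subseteq> set xs - {xs ! x}} \<noteq> 10"
      using contains_K5I [OF S F] K5 by blast
    \<comment> \<open>Edges and non-edges add up to 10, so excluding 8 and 10 edges excludes 2 and 0
      non-edges.\<close>
    ultimately show ?thesis
      unfolding eq nonedges_ok_iff by linarith
  qed
  then show ?thesis by (simp add: fives_ok_def)
qed

abbreviation psi_list :: "('a \<Rightarrow> 'a \<Rightarrow> 'a \<Rightarrow> bool) \<Rightarrow> 'a list \<Rightarrow> int" where
  "psi_list E ys \<equiv> psi E (ys ! 0) (ys ! 1) (ys ! 2) (ys ! 3) (ys ! 4) (ys ! 5)"

text \<open>The sum depends only on the set \<open>S\<close>, so it may be computed from a
  transposition-minimal listing, which the finite check covers.\<close>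

lemma sum_psi_six_set_nonneg:
  assumes "admissible V F" "S \<subseteq> V" "card S = 6"
  shows "0 \<le> (\<Sum>ys\<in>permutations_of_set S. psi_list (adj F) ys)"
proof -
  obtain xs where xs: "distinct xs" "set xs = S" "length xs = 6" "transp_minimal 6 (bits (adj F) xs)"
    using ex_transp_minimal [OF adj_swap assms(3)] .
  have "0 \<le> psi_sum (bits (adj F) xs)"
    using fives_ok_bits [OF assms(1) xs(1,3)] xs assms(2)
    by (intro psi_sum_nonneg) (simp_all add: bits_def length_triples_6)
  with sum_psi_permutations [of "adj F", OF adj_swap xs(1,3)] xs(2) show ?thesis by simp
qed

subsection \<open>The upper bound\<close>

lemma sum_lists_Suc:
  "sum f {ys. set ys \<subseteq> V \<and> length ys = Suc n} =
    (\<Sum>y\<in>V. \<Sum>ys | set ys \<subseteq> V \<and> length ys = n. f (y # ys))"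
proof -
  have "inj_on (\<lambda>(xs, n). n # xs) ({xs. set xs \<subseteq> V \<and> length xs = n} \<times> V)"
    by (auto simp: inj_on_def)
  then have "sum f {ys. set ys \<subseteq> V \<and> length ys = Suc n} =
      (\<Sum>ys | set ys \<subseteq> V \<and> length ys = n. \<Sum>y\<in>V. f (y # ys))"
    unfolding lists_length_Suc_eq by (simp add: sum.reindex sum.cartesian_product case_prod_unfold)
  also have "\<dots> = (\<Sum>y\<in>V. \<Sum>ys | set ys \<subseteq> V \<and> length ys = n. f (y # ys))"
    by (rule sum.swap)
  finally show ?thesis .
qed

lemma lists_length_0: "{ys. set ys \<subseteq> V \<and> length ys = 0} = {[]}"
  by auto

lemma sum_lists_6:
  "(\<Sum>ys | set ys \<subseteq> V \<and> length ys = 6. f (ys ! 0) (ys ! 1) (ys ! 2) (ys ! 3) (ys ! 4) (ys ! 5)) =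
    (\<Sum>u\<in>V. \<Sum>v\<in>V. \<Sum>a\<in>V. \<Sum>b\<in>V. \<Sum>c\<in>V. \<Sum>d\<in>V. f u v a b c d)"
proof -
  have 6: "6 = Suc (Suc (Suc (Suc (Suc (Suc 0)))))" by simp
  show ?thesis unfolding 6 sum_lists_Suc lists_length_0 by simp
qed

lemma sum_lists_3:
  "(\<Sum>ys | set ys \<subseteq> V \<and> length ys = 3. f (set ys)) = (\<Sum>x\<in>V. \<Sum>y\<in>V. \<Sum>z\<in>V. f {x, y, z})"
proof -
  have 3: "3 = Suc (Suc (Suc 0))" by simp
  show ?thesis unfolding 3 sum_lists_Suc lists_length_0 by simp
qed

lemma sum_power2_double:
  fixes f :: "'a \<Rightarrow> 'b \<Rightarrow> int"
  shows "(\<Sum>a\<in>A. \<Sum>b\<in>B. f a b)\<^sup>2 = (\<Sum>a\<in>A. \<Sum>b\<in>B. \<Sum>c\<in>A. \<Sum>d\<in>B. f a b * f c d)"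
  by (simp only: power2_eq_square sum_distrib_right) (simp only: sum_distrib_left)

lemma sum_power2_swap:
  fixes f :: "'a \<Rightarrow> 'b \<Rightarrow> int"
  shows "(\<Sum>x\<in>A. \<Sum>y\<in>A. \<Sum>q\<in>Q. f x q * f y q) = (\<Sum>q\<in>Q. (\<Sum>x\<in>A. f x q)\<^sup>2)"
proof -
  have "(\<Sum>q\<in>Q. (\<Sum>x\<in>A. f x q)\<^sup>2) = (\<Sum>q\<in>Q. \<Sum>x\<in>A. \<Sum>y\<in>A. f x q * f y q)"
    by (simp add: power2_eq_square sum_product)
  also have "\<dots> = (\<Sum>x\<in>A. \<Sum>q\<in>Q. \<Sum>y\<in>A. f x q * f y q)"
    by (rule sum.swap)
  also have "\<dots> = (\<Sum>x\<in>A. \<Sum>y\<in>A. \<Sum>q\<in>Q. f x q * f y q)"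
    by (intro sum.cong refl sum.swap)
  finally show ?thesis by simp
qed

text \<open>Each of the four edge indicators leaves three of the six variables free and contributes
  \<open>n ^ 3\<close> times the sum over ordered triples. The \<open>phi\<close> and
  \<open>omega\<close> products become squares once \<open>u\<close>, \<open>v\<close> are fixed,
  the \<open>delta\<close> product once \<open>a\<close>, \<open>b\<close>, \<open>c\<close>,
  \<open>d\<close> are fixed; all enter with a negative sign and are dropped.\<close>

lemma sum_psi_le:
  fixes E :: "'a \<Rightarrow> 'a \<Rightarrow> 'a \<Rightarrow> bool" and V :: "'a set"
  defines "n \<equiv> int (card V)"
  shows "(\<Sum>u\<in>V. \<Sum>v\<in>V. \<Sum>a\<in>V. \<Sum>b\<in>V. \<Sum>c\<in>V. \<Sum>d\<in>V. psi E u v a b c d)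
    \<le> 36 * n ^ 6 - 48 * n ^ 3 * (\<Sum>x\<in>V. \<Sum>y\<in>V. \<Sum>z\<in>V. of_bool (E x y z))"
proof -
  define T where "T = (\<Sum>x\<in>V. \<Sum>y\<in>V. \<Sum>z\<in>V. of_bool (E x y z) :: int)"
  define S where "S f = (\<Sum>u\<in>V. \<Sum>v\<in>V. \<Sum>a\<in>V. \<Sum>b\<in>V. \<Sum>c\<in>V. \<Sum>d\<in>V. f u v a b c d)"
    for f :: "'a \<Rightarrow> 'a \<Rightarrow> 'a \<Rightarrow> 'a \<Rightarrow> 'a \<Rightarrow> 'a \<Rightarrow> int"
  have T: "S (\<lambda>u v a b c d. of_bool (E u v a)) = n ^ 3 * T" "S (\<lambda>u v a b c d. of_bool (E u v b)) = n ^ 3 * T"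
    "S (\<lambda>u v a b c d. of_bool (E u v c)) = n ^ 3 * T" "S (\<lambda>u v a b c d. of_bool (E u v d)) = n ^ 3 * T"
    by (simp_all add: S_def T_def n_def sum_distrib_left power3_eq_cube mult.assoc)
  have phi: "S (\<lambda>u v a b c d. phi E u v a b * phi E u v c d) = (\<Sum>u\<in>V. \<Sum>v\<in>V. (\<Sum>a\<in>V. \<Sum>b\<in>V. phi E u v a b)\<^sup>2)"
    and omega: "S (\<lambda>u v a b c d. omega E u v a b * omega E u v c d) = (\<Sum>u\<in>V. \<Sum>v\<in>V. (\<Sum>a\<in>V. \<Sum>b\<in>V. omega E u v a b)\<^sup>2)"
    unfolding S_def sum_power2_double by (rule refl)+
  have delta: "S (\<lambda>u v a b c d. delta E a b c d u * delta E a b c d v) =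
      (\<Sum>(a, b, c, d)\<in>V \<times> V \<times> V \<times> V. (\<Sum>x\<in>V. delta E a b c d x)\<^sup>2)"
    using sum_power2_swap [of "\<lambda>x (a, b, c, d). delta E a b c d x" "V \<times> V \<times> V \<times> V" V]
    unfolding S_def by (simp add: sum.cartesian_product case_prod_unfold)
  have "S (psi E) = S (\<lambda>u v a b c d. 36) - 12 * (S (\<lambda>u v a b c d. of_bool (E u v a)) + S (\<lambda>u v a b c d. of_bool (E u v b))
      + S (\<lambda>u v a b c d. of_bool (E u v c)) + S (\<lambda>u v a b c d. of_bool (E u v d)))
      - S (\<lambda>u v a b c d. phi E u v a b * phi E u v c d) - 32 * S (\<lambda>u v a b c d. omega E u v a b * omega E u v c d)
      - 60 * S (\<lambda>u v a b c d. delta E a b c d u * delta E a b c d v)"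
    unfolding S_def psi_def by (simp only: sum_subtractf sum.distrib sum_distrib_left [symmetric])
  also have "S (\<lambda>u v a b c d. 36) = 36 * n ^ 6"
    by (simp add: S_def n_def power_def numeral_eq_Suc)
  also have "36 * n ^ 6 - 12 * (S (\<lambda>u v a b c d. of_bool (E u v a)) + S (\<lambda>u v a b c d. of_bool (E u v b))
      + S (\<lambda>u v a b c d. of_bool (E u v c)) + S (\<lambda>u v a b c d. of_bool (E u v d)))
      - S (\<lambda>u v a b c d. phi E u v a b * phi E u v c d) - 32 * S (\<lambda>u v a b c d. omega E u v a b * omega E u v c d)
      - 60 * S (\<lambda>u v a b c d. delta E a b c d u * delta E a b c d v) \<le> 36 * n ^ 6 - 48 * n ^ 3 * T"
  proof -
    have "0 \<le> S (\<lambda>u v a b c d. phi E u v a b * phi E u v c d)" "0 \<le> S (\<lambda>u v a b c d. omega E u v a b * omega E u v c d)"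
      "0 \<le> S (\<lambda>u v a b c d. delta E a b c d u * delta E a b c d v)"
      unfolding phi omega delta by (auto intro!: sum_nonneg)
    moreover have "X - 12 * (y + y + y + y) - p - 32 * q - 60 * r \<le> X - 48 * y"
      if "0 \<le> p" "0 \<le> q" "0 \<le> r" for X y p q r :: int
      using that by simp
    ultimately show ?thesis unfolding T mult.assoc by blast
  qed
  finally show ?thesis by (simp add: S_def T_def)
qed

lemma abs_phi_le: "\<bar>phi E u v a b\<bar> \<le> 6"
  unfolding phi_def by (induction "E u v a" "E u v b" "E u a b" "E v a b" rule: phi_tab.induct) simp_all

lemma abs_omega_le: "\<bar>omega E u v a b\<bar> \<le> 1"
  unfolding omega_def by (induction "E u v a" "E u v b" "E u a b" "E v a b" rule: omega_tab.induct) simp_all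

lemma abs_delta_tab_le: "\<bar>delta_tab p q r s t w\<bar> \<le> 1"
  by (induction p q r s t w rule: delta_tab.induct) simp_all

lemma abs_delta_le: "\<bar>delta E a b c d x\<bar> \<le> 1"
  by (simp add: delta_def abs_delta_tab_le)

text \<open>The crude bound is 36 - 48 - 36 - 32 - 60 = -140. It serves for the tuples with a
  repeated vertex, to which the finite check does not apply.\<close>

lemma psi_ge: "-140 \<le> psi E u v a b c d"
proof -
  have "\<bar>phi E u v a b * phi E u v c d\<bar> \<le> 6 * 6"
    unfolding abs_mult by (intro mult_mono abs_phi_le) simp_all
  moreover have "\<bar>omega E u v a b * omega E u v c d\<bar> \<le> 1 * 1"
    unfolding abs_mult by (intro mult_mono abs_omega_le) simp_all
  moreover have "\<bar>delta E a b c d u * delta E a b c d v\<bar> \<le> 1 * 1"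
    unfolding abs_mult by (intro mult_mono abs_delta_le) simp_all
  moreover have "of_bool (E u v a) + of_bool (E u v b) + of_bool (E u v c) + of_bool (E u v d) \<le> (4 :: int)"
    by simp
  moreover have "- 140 \<le> 36 - 12 * t - p - 32 * q - 60 * r"
    if "\<bar>p\<bar> \<le> 6 * 6" "\<bar>q\<bar> \<le> 1 * 1" "\<bar>r\<bar> \<le> 1 * 1" "t \<le> 4" for p q r t :: int
    using that by simp
  ultimately show ?thesis unfolding psi_def by blast
qed

text \<open>A triple with a repeated vertex forms a set of fewer than three elements and is no edge,
  while every edge has six orderings.\<close>

lemma sum_adj:
  assumes "three_graph V F"
  shows "(\<Sum>x\<in>V. \<Sum>y\<in>V. \<Sum>z\<in>V. of_bool (adj F x y z)) = 6 * int (card F)"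
proof -
  have V: "finite V" and F: "finite F" "\<And>e. e \<in> F \<Longrightarrow> e \<subseteq> V" "\<And>e. e \<in> F \<Longrightarrow> card e = 3"
    using assms three_graph_card_le(1) [OF assms] by (auto simp: three_graph_def)
  have fin: "finite e" if "e \<in> F" for e
    using F(2) [OF that] V by (rule finite_subset)
  have eq: "{ys. set ys \<subseteq> V \<and> length ys = 3} \<inter> {ys. set ys \<in> F} = (\<Union>e\<in>F. permutations_of_set e)"
  proof (intro equalityI subsetI)
    fix ys assume "ys \<in> {ys. set ys \<subseteq> V \<and> length ys = 3} \<inter> {ys. set ys \<in> F}"
    then have "set ys \<in> F" "distinct ys"
      using F(3) by (auto intro: card_distinct)
    then show "ys \<in> (\<Union>e\<in>F. permutations_of_set e)" by auto
  next
    fix ys assume "ys \<in> (\<Union>e\<in>F. permutations_of_set e)"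
    then obtain e where e: "e \<in> F" "ys \<in> permutations_of_set e" by blast
    then show "ys \<in> {ys. set ys \<subseteq> V \<and> length ys = 3} \<inter> {ys. set ys \<in> F}"
      using F(2,3) [OF e(1)] length_finite_permutations_of_set [OF e(2)] permutations_of_setD(1) [OF e(2)] by simp
  qed
  have "(\<Sum>x\<in>V. \<Sum>y\<in>V. \<Sum>z\<in>V. of_bool (adj F x y z)) = (\<Sum>ys | set ys \<subseteq> V \<and> length ys = 3. of_bool (set ys \<in> F) :: int)"
    unfolding adj_def by (rule sum_lists_3 [symmetric])
  also have "\<dots> = int (card (\<Union>e\<in>F. permutations_of_set e))"
    using finite_lists_length_eq [OF V] by (simp add: sum_of_bool_eq eq)
  also have "card (\<Union>e\<in>F. permutations_of_set e) = (\<Sum>e\<in>F. card (permutations_of_set e))"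
    using F(1) by (intro card_UN_disjoint) (auto dest: permutations_of_setD)
  also have "\<dots> = card F * 6"
    using F(3) fin by (simp add: numeral_eq_Suc)
  finally show ?thesis by simp
qed

text \<open>The lists without repetition, grouped by their vertex sets, have a nonnegative sum;
  every other list contributes at least -140. Comparing with the upper bound for the whole sum gives
  288 = 48 * 6 and 176 = 36 + 140.\<close>

lemma admissible_card_le:
  assumes "admissible V F"
  shows "288 * int (card V) ^ 3 * int (card F) \<le>
    176 * int (card V) ^ 6 - 140 * int (card {ys. length ys = 6 \<and> distinct ys \<and> set ys \<subseteq> V})"
proof -
  define A where "A = {ys. set ys \<subseteq> V \<and> length ys = 6}"
  define D where "D = {ys. length ys = 6 \<and> distinct ys \<and> set ys \<subseteq> V}"
  have tg: "three_graph V F" and V: "finite V"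
    using assms by (auto simp: admissible_def three_graph_def)
  have A: "finite A" "card A = card V ^ 6"
    unfolding A_def using V by (simp_all add: finite_lists_length_eq card_lists_length_eq)
  have DA: "D \<subseteq> A" by (auto simp: D_def A_def)
  have D: "D = (\<Union>S\<in>{S. S \<subseteq> V \<and> card S = 6}. permutations_of_set S)"
    unfolding D_def by (auto simp: permutations_of_set_def distinct_card)
  have "0 \<le> (\<Sum>S | S \<subseteq> V \<and> card S = 6. \<Sum>ys\<in>permutations_of_set S. psi_list (adj F) ys)"
    by (rule sum_nonneg) (use sum_psi_six_set_nonneg [OF assms] in blast)
  also have "\<dots> = (\<Sum>ys\<in>D. psi_list (adj F) ys)"
    unfolding D using V by (intro sum.UNION_disjoint [symmetric]) (auto dest: permutations_of_setD)
  finally have "0 \<le> (\<Sum>ys\<in>D. psi_list (adj F) ys)" .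
  moreover have "- 140 * (int (card A) - int (card D)) \<le> (\<Sum>ys\<in>A - D. psi_list (adj F) ys)"
    using sum_bounded_below [of "A - D" "-140" "psi_list (adj F)"] psi_ge [of "adj F"] DA A(1)
    by (simp add: card_Diff_subset finite_subset [OF DA] card_mono of_nat_diff)
  moreover have "(\<Sum>ys\<in>A. psi_list (adj F) ys) = (\<Sum>ys\<in>A - D. psi_list (adj F) ys) + (\<Sum>ys\<in>D. psi_list (adj F) ys)"
    by (rule sum.subset_diff [OF DA A(1)])
  moreover have "(\<Sum>ys\<in>A. psi_list (adj F) ys) \<le> 36 * int (card V) ^ 6 - 288 * int (card V) ^ 3 * int (card F)"
    using sum_psi_le [of "adj F" V] unfolding A_def sum_lists_6 sum_adj [OF tg] by simp
  ultimately show ?thesis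
    using A(2) by (simp add: D_def)
qed

lemma real_choose_3: "real (n choose 3) = real n * (real n - 1) * (real n - 2) / 6"
proof (induction n)
  case (Suc n)
  have "real (n choose 2) = real n * (real n - 1) / 2"
    by (induction n) (simp_all add: numeral_2_eq_2 field_simps)
  moreover have "Suc n choose 3 = (n choose 2) + (n choose 3)"
    by (simp add: numeral_eq_Suc)
  ultimately show ?case using Suc by (simp add: field_simps)
qed simp

lemma max_edges_le:
  assumes "n \<ge> 6"
  shows "real (max_edges n) \<le> (176 * real n ^ 6 - 140 * (real n * (real n - 1) * (real n - 2) * (real n - 3) *
    (real n - 4) * (real n - 5))) / (288 * real n ^ 3)"
proof -
  obtain V :: "nat set" and F where V: "card V = n" "admissible V F" "card F = max_edges n"
    using max_edges_attained by blast
  \<comment> \<open>With \<open>n = m + 6\<close> the number of injective 6-tuples is a product of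
    sums, free of truncated subtraction.\<close>
  obtain m where m: "n = m + 6" using assms by (metis le_add_diff_inverse2)
  have "finite V" using V(2) by (simp add: admissible_def three_graph_def)
  then have "card {ys. length ys = 6 \<and> distinct ys \<and> set ys \<subseteq> V} = \<Prod>{m + 1..m + 6}"
    using card_lists_distinct_length_eq [of V 6] V(1) m by simp
  also have "\<dots> = (m + 1) * (m + 2) * (m + 3) * (m + 4) * (m + 5) * (m + 6)"
    by (simp add: numeral_eq_Suc prod.nat_ivl_Suc')
  finally have card: "card {ys. length ys = 6 \<and> distinct ys \<and> set ys \<subseteq> V} =
      (m + 1) * (m + 2) * (m + 3) * (m + 4) * (m + 5) * (m + 6)" .
  have D: "real (card {ys. length ys = 6 \<and> distinct ys \<and> set ys \<subseteq> V}) =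
      real n * (real n - 1) * (real n - 2) * (real n - 3) * (real n - 4) * (real n - 5)"
    unfolding card by (simp add: m algebra_simps)
  have "real_of_int (288 * int (card V) ^ 3 * int (card F)) \<le>
    real_of_int (176 * int (card V) ^ 6 - 140 * int (card {ys. length ys = 6 \<and> distinct ys \<and> set ys \<subseteq> V}))"
    using admissible_card_le [OF V(2)] by (simp only: of_int_le_iff)
  then have "real (max_edges n) * (288 * real n ^ 3) \<le> 176 * real n ^ 6 - 140 * (real n * (real n - 1) * (real n - 2) * (real n - 3) *
    (real n - 4) * (real n - 5))"
    by (simp add: V D mult_ac)
  then show ?thesis
    using assms by (subst pos_le_divide_eq) simp_all
qed

subsection \<open>The lower bound\<close>

definition crossing :: "'a set \<Rightarrow> 'a set \<Rightarrow> 'a set set" where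
  "crossing V A = {e. e \<subseteq> V \<and> card e = 3 \<and> e \<inter> A \<noteq> {} \<and> e - A \<noteq> {}}"

text \<open>Every triple of \<open>S\<close> crosses, lies inside \<open>A\<close>, or avoids
  \<open>A\<close>. The additive form avoids subtraction of natural numbers.\<close>

lemma card_crossing_subset:
  assumes "finite V" "S \<subseteq> V"
  shows "card {e \<in> crossing V A. e \<subseteq> S} + ((card (S \<inter> A) choose 3) + (card (S - A) choose 3)) = card S choose 3"
proof -
  have S: "finite S" using assms by (rule finite_subset [rotated])
  let ?in = "{e. e \<subseteq> S \<inter> A \<and> card e = 3}" and ?out = "{e. e \<subseteq> S - A \<and> card e = 3}"
  have "{e. e \<subseteq> S \<and> card e = 3} = {e \<in> crossing V A. e \<subseteq> S} \<union> (?in \<union> ?out)"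
    using assms(2) by (auto simp: crossing_def)
  moreover have "finite ?in" "finite ?out" "finite {e \<in> crossing V A. e \<subseteq> S}"
    using S by simp_all
  moreover have "?in \<inter> ?out = {}"
  proof -
    have "card e \<noteq> 3" if "e \<subseteq> S \<inter> A" "e \<subseteq> S - A" for e
    proof -
      have "e = {}" using that by blast
      then show ?thesis by simp
    qed
    then show ?thesis by blast
  qed
  moreover have "{e \<in> crossing V A. e \<subseteq> S} \<inter> (?in \<union> ?out) = {}"
    by (auto simp: crossing_def)
  ultimately have "card {e. e \<subseteq> S \<and> card e = 3} = card {e \<in> crossing V A. e \<subseteq> S} + (card ?in + card ?out)"
    by (simp add: card_Un_disjoint)
  then show ?thesis
    using n_subsets [OF S, of 3] n_subsets [of "S \<inter> A" 3] n_subsets [of "S - A" 3] S by simp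
qed

lemma crossing_five:
  assumes "finite V" "S \<subseteq> V" "card S = 5"
  shows "card {e \<in> crossing V A. e \<subseteq> S} = 0 \<or> card {e \<in> crossing V A. e \<subseteq> S} = 6 \<or>
    card {e \<in> crossing V A. e \<subseteq> S} = 9"
proof -
  have "finite S" using assms finite_subset by blast
  then have "card (S \<inter> A) + card (S - A) = 5"
    using assms(3) card_Un_disjoint [of "S \<inter> A" "S - A"] by (simp add: Int_Diff_Un Int_Diff_disjoint)
  moreover define k l where "k = card (S \<inter> A)" "l = card (S - A)"
  ultimately have kl: "k + l = 5" by simp
  then have "k = 0 \<or> k = 1 \<or> k = 2 \<or> k = 3 \<or> k = 4 \<or> k = 5" by linarith
  \<comment> \<open>The splits 5+0, 4+1 and 3+2 leave 10, 4 and 1 triples uncrossed.\<close>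
  then have "(k choose 3) + (l choose 3) = 10 \<or> (k choose 3) + (l choose 3) = 4 \<or> (k choose 3) + (l choose 3) = 1"
    using kl by (elim disjE) (auto simp: choose_small numeral_eq_Suc)
  then show ?thesis
    using card_crossing_subset [OF assms(1,2), of A] unfolding assms(3) k_l_def [symmetric] choose_small
    by linarith
qed

lemma admissible_crossing:
  assumes "finite V"
  shows "admissible V (crossing V A)"
proof -
  have "\<not> contains_K5 V (crossing V A)"
  proof
    assume "contains_K5 V (crossing V A)"
    then obtain f where f: "inj_on f {..<5::nat}" "f ` {..<5} \<subseteq> V"
      "\<And>e. e \<in> complete_edges {..<5} \<Longrightarrow> f ` e \<in> crossing V A"
      by (auto simp: contains_K5_def contains_copy_def)
    have S: "card (f ` {..<5}) = 5" using f(1) by (simp add: card_image)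
    have "{e. e \<subseteq> f ` {..<5} \<and> card e = 3} \<subseteq> {e \<in> crossing V A. e \<subseteq> f ` {..<5}}"
    proof
      fix e assume "e \<in> {e. e \<subseteq> f ` {..<5} \<and> card e = 3}"
      then obtain T where T: "T \<subseteq> {..<5}" "e = f ` T" "card e = 3"
        by (auto simp: subset_image_iff)
      then have "card T = 3" using f(1) by (metis card_image inj_on_subset)
      then show "e \<in> {e \<in> crossing V A. e \<subseteq> f ` {..<5}}"
        using T f(3) [of T] by (auto simp: complete_edges_def)
    qed
    then have "card {e. e \<subseteq> f ` {..<5} \<and> card e = 3} \<le> card {e \<in> crossing V A. e \<subseteq> f ` {..<5}}"
      by (intro card_mono) auto
    moreover have "card {e. e \<subseteq> f ` {..<5} \<and> card e = 3} = 10"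
      using n_subsets [of "f ` {..<5}" 3] S by (simp add: choose_small)
    ultimately show False
      using crossing_five [OF assms f(2) S, of A] by linarith
  qed
  moreover have "\<not> spans (crossing V A) S 8" if "S \<subseteq> V" "card S = 5" for S
    unfolding spans_def using crossing_five [OF assms that, of A] by linarith
  moreover have "three_graph V (crossing V A)"
    using assms by (auto simp: three_graph_def crossing_def)
  ultimately show ?thesis by (auto simp: admissible_def)
qed

lemma real_choose_3_le: "real (n choose 3) \<le> real n ^ 3 / 6"
proof -
  have "real (n choose 3) * 6 \<le> real n ^ 3"
    using binomial_fact_pow [of n 3] by (simp add: fact_numeral flip: of_nat_mult of_nat_power)
  then show ?thesis by simp
qed

text \<open>The crossing triples of two halves are all triples except those inside a half, and the
  halves have at most \<open>n / 2\<close> and \<open>(n + 1) / 2\<close> vertices.\<close>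

lemma max_edges_ge:
  "real (max_edges n) \<ge> real n * (real n - 1) * (real n - 2) / 6 - (real n / 2) ^ 3 / 6 - ((real n + 1) / 2) ^ 3 / 6"
proof -
  let ?V = "{..<n}" and ?A = "{..<n div 2}"
  have "card {e \<in> crossing ?V ?A. e \<subseteq> ?V} + ((n div 2 choose 3) + (n - n div 2 choose 3)) = n choose 3"
  proof -
    have "?V \<inter> ?A = {..<n div 2}" "?V - ?A = {n div 2..<n}" by auto
    then show ?thesis using card_crossing_subset [of ?V ?V ?A] by simp
  qed
  moreover have "{e \<in> crossing ?V ?A. e \<subseteq> ?V} = crossing ?V ?A"
    by (auto simp: crossing_def)
  moreover have "card (crossing ?V ?A) \<le> max_edges n"
    using max_edges_upper [OF admissible_crossing [of ?V ?A]] by simp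
  ultimately have "n choose 3 \<le> max_edges n + ((n div 2 choose 3) + (n - n div 2 choose 3))"
    by (metis add_le_mono1)
  then have "real (n choose 3) \<le> real (max_edges n) + (real (n div 2 choose 3) + real (n - n div 2 choose 3))"
    by (metis of_nat_add of_nat_mono)
  moreover have "real (n div 2 choose 3) \<le> (real n / 2) ^ 3 / 6"
  proof -
    have "real (n div 2) \<le> real n / 2" by linarith
    then have "real (n div 2) ^ 3 \<le> (real n / 2) ^ 3" by (intro power_mono) simp_all
    then show ?thesis using real_choose_3_le [of "n div 2"] by linarith
  qed
  moreover have "real (n - n div 2 choose 3) \<le> ((real n + 1) / 2) ^ 3 / 6"
  proof -
    have "2 * (n - n div 2) \<le> n + 1" by presburger
    then have "real (2 * (n - n div 2)) \<le> real (n + 1)" by (rule of_nat_mono)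
    then have "real (n - n div 2) \<le> (real n + 1) / 2" by simp
    then have "real (n - n div 2) ^ 3 \<le> ((real n + 1) / 2) ^ 3" by (intro power_mono) simp_all
    then show ?thesis using real_choose_3_le [of "n - n div 2"] by linarith
  qed
  ultimately show ?thesis by (simp add: real_choose_3)
qed

theorem theorem9:
  "(\<lambda>n. real (max_edges n) / real (n choose 3)) \<longlonglongrightarrow> 3 / 4"
proof (rule tendsto_sandwich)
  define lower where "lower = (\<lambda>n. (real n * (real n - 1) * (real n - 2) / 6 - (real n / 2) ^ 3 / 6
    - ((real n + 1) / 2) ^ 3 / 6) / (real n * (real n - 1) * (real n - 2) / 6))"
  define upper where "upper = (\<lambda>n. (176 * real n ^ 6 - 140 * (real n * (real n - 1) * (real n - 2) * (real n - 3) *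
    (real n - 4) * (real n - 5))) / (288 * real n ^ 3) / (real n * (real n - 1) * (real n - 2) / 6))"
  show "\<forall>\<^sub>F n in sequentially. lower n \<le> real (max_edges n) / real (n choose 3)"
    unfolding lower_def real_choose_3 using eventually_ge_at_top [of 2]
    by eventually_elim (intro divide_right_mono max_edges_ge; simp)
  show "\<forall>\<^sub>F n in sequentially. real (max_edges n) / real (n choose 3) \<le> upper n"
    unfolding upper_def real_choose_3 using eventually_ge_at_top [of 6]
    by eventually_elim (intro divide_right_mono max_edges_le; simp)
  \<comment> \<open>The leading coefficients give (1/6 - 1/48 - 1/48) / (1/6) = 3/4.\<close>
  show "lower \<longlonglongrightarrow> 3 / 4"
    unfolding lower_def by (real_asymp, simp add: power3_eq_cube)
  \<comment> \<open>The degenerate tuples affect only lower-order terms; the leading coefficients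
    give (176 - 140) / 288 * 6 = 3/4.\<close>
  show "upper \<longlonglongrightarrow> 3 / 4"
    unfolding upper_def by real_asymp
qed

end
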